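(* Let $N\ge 3$ be an integer and let $\frac{N}{N-2}\le p<\frac{N+2}{N-2}$. Then the equation $$u''+\Big(\frac{N-1}{r}+\frac r2\Big)u'+\frac1{p-1}u+u^p=0,\qquad r>0,\qquad (E)$$ has a continuum of singular positive solutions (i.e. the set of singular positive solutions has the cardinality of the continuum). In the case $\frac{N}{N-2}<p<\frac{N+2}{N-2}$, any singular positive solution $u$ of $(E)$ satisfies $$\lim_{r\to0}r^{2/(p-1)}u(r)=L,\qquad L=\Big\{\frac{2}{p-1}\Big(N-2-\frac2{p-1}\Big)\Big\}^{1/(p-1)}.$$ In the case $p=\frac{N}{N-2}$, any singular positive solution $u$ of $(E)$ satisfies $$\lim_{r\to0}r^{N-2}(-\log r)^{(N-2)/2}u(r)=\Big(\frac{(N-2)^2}{2}\Big)^{(N-2)/2}.$$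
   Context: A singular positive solution of $(E)$ is a function $u\in C^2(0,\infty)$ with $u(r)>0$ for all $r>0$, satisfying $(E)$ for all $r>0$, and $u(r)\to\infty$ as $r\to0$. *)

theory Defs
  imports "HOL-Analysis.Analysis" "HOL-Library.Equipollence"
begin

definition C2_on :: "(real \<Rightarrow> real) \<Rightarrow> real set \<Rightarrow> bool" where
  "C2_on u S \<longleftrightarrow>
     (\<forall>r\<in>S. u differentiable (at r)) \<and> (deriv u) C1_differentiable_on S"

definition solves_E :: "nat \<Rightarrow> real \<Rightarrow> (real \<Rightarrow> real) \<Rightarrow> bool" where
  "solves_E N p u \<longleftrightarrow>
     (\<forall>r>0. deriv (deriv u) r + ((real N - 1) / r + r / 2) * deriv u r
              + 1 / (p - 1) * u r + u r powr p = 0)"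

(* Only the values of u on (0,\<infinity>) matter here; the values on r \<le> 0 are junk. *)
definition singular_positive_solution :: "nat \<Rightarrow> real \<Rightarrow> (real \<Rightarrow> real) \<Rightarrow> bool" where
  "singular_positive_solution N p u \<longleftrightarrow>
     C2_on u {0<..} \<and> (\<forall>r>0. u r > 0) \<and> solves_E N p u \<and> filterlim u at_top (at_right 0)"

(* The set of singular positive solutions as functions on (0,\<infinity>): extensionality fixes the
   values on r \<le> 0, so that each function on (0,\<infinity>) is counted exactly once. *)
definition singular_positive_solutions :: "nat \<Rightarrow> real \<Rightarrow> (real \<Rightarrow> real) set" where
  "singular_positive_solutions N p =
     {u \<in> extensional {0<..}. singular_positive_solution N p u}"

end

theory Submission
  imports Defs
begin

text \<open>Put \<open>n = N - 2\<close>, \<open>a = 2 / (p - 1)\<close>, \<open>t = ln r\<close> and \<open>v = r powr a * u\<close>. Because \<open>a / 2 = 1 / (p - 1)\<close>,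
  the terms of \<open>(E)\<close> carrying the factor \<open>r\<close> leave only damping:
  \<open>v'' + (r\<^sup>2 / 2 - b) v' - c v + v powr p = 0\<close> with \<open>b = 2 a - n > 0\<close> and \<open>c = a (n - a) \<ge> 0\<close>.

  Asymptotics: near the origin the energy \<open>v'\<^sup>2 / 2 - c v\<^sup>2 / 2 + v powr (p + 1) / (p + 1)\<close> is monotone
  along the flow, so \<open>v\<close> is bounded, \<open>v'\<close> and \<open>v''\<close> tend to \<open>0\<close>, and \<open>v\<close> tends to \<open>0\<close> or to \<open>L\<close>. If \<open>v\<close>
  tends to \<open>0\<close> while \<open>u\<close> is unbounded, the logarithmic derivative of \<open>u\<close> in \<open>s = - t\<close> stays away from \<open>0\<close>.
  For \<open>c > 0\<close> it then forces \<open>u\<close> to grow too fast; for \<open>c = 0\<close> it gives \<open>dv/ds / v powr p \<longlonglongrightarrow> - 1 / b\<close>, which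
  is integrated explicitly.

  Existence: start at rest with \<open>v = v0\<close>. For \<open>c > 0\<close> start where \<open>r\<^sup>2 = 2 b\<close>: the damping changes sign there,
  so the energy decreases in both directions and a negative initial energy keeps \<open>v\<close> away from \<open>0\<close>.
  For \<open>c = 0\<close> start at a larger radius with small \<open>v0\<close> and use linear barriers for \<open>v'\<close>. Different \<open>v0\<close>
  give different solutions.\<close>

subsection \<open>Barrier and decay lemmas\<close>

text \<open>In \<open>s = - ln r\<close> the origin lies at infinity and the damping tends to
  \<open>b\<close> there. The two bounds on \<open>p\<close> are the two sign conditions:
  \<open>p < (N + 2) / (N - 2)\<close> says \<open>b > 0\<close>, so that energy is lost towards the
  origin, and \<open>p \<ge> N / (N - 2)\<close> says \<open>c \<ge> 0\<close>, with equality
  exactly at the endpoint. The energy alone cannot select the limit: any solution that is bounded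
  near the origin also has \<open>v\<close> tending to 0. Unboundedness of \<open>u\<close>
  therefore has to be turned into quantitative information, first in \<open>Q_pos\<close>, then in
  \<open>not_regular\<close>. For existence the obstacle is that \<open>x powr p\<close> is not
  globally Lipschitz, while the damping grows like \<open>exp (2 * t)\<close> away from the origin.
  The nonlinearity is truncated, a Picard iteration in a weighted norm solves the truncated problem
  for all times, and a barrier shows that the solution never reaches the truncated range. Starting
  at rest lets the forward and the backward half fit together without a kink.\<close>

lemma first_exit:
  fixes f :: "real \<Rightarrow> real"
  assumes "continuous_on {a..b} f" "a \<le> b" "f a > 0" "f b \<le> 0"
  obtains t where "a < t" "t \<le> b" "f t = 0" "\<And>s. a \<le> s \<Longrightarrow> s < t \<Longrightarrow> f s > 0"
proof -
  define S where "S = {s \<in> {a..b}. f s \<le> 0}"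
  have "closed S"
    using continuous_on_closed_Collect_le[OF assms(1) continuous_on_const closed_atLeastAtMost, of 0]
    by (simp add: S_def)
  moreover have "bounded S"
    by (rule bounded_subset[of "{a..b}"]) (auto simp: S_def)
  ultimately have "compact S"
    using compact_eq_bounded_closed by blast
  moreover have "b \<in> S" using assms by (auto simp: S_def)
  ultimately obtain t where t: "t \<in> S" "\<And>s. s \<in> S \<Longrightarrow> t \<le> s"
    using compact_attains_inf[of S] by blast
  have at: "a < t" "t \<le> b" using t(1) assms(3) by (auto simp: S_def less_le)
  have pos: "f s > 0" if "a \<le> s" "s < t" for s
    using t(2)[of s] that at by (force simp: S_def)
  have "continuous_on {a..t} f" by (rule continuous_on_subset[OF assms(1)]) (use at in auto)
  then obtain x where "a \<le> x" "x \<le> t" "f x = 0"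
    using IVT2'[of f t 0 a] t(1) at assms(3) by (auto simp: S_def)
  with pos[of x] have "f t = 0" by (cases "x = t") auto
  with at pos show ?thesis by (intro that[of t])
qed

lemma continuous_on_from_DERIV:
  fixes f f' :: "real \<Rightarrow> real"
  assumes "\<And>s. a \<le> s \<Longrightarrow> (f has_real_derivative f' s) (at s)"
  shows "continuous_on {a..b} f"
  by (rule DERIV_continuous_on[of _ _ f'], rule has_field_derivative_at_within) (use assms in auto)

lemma DERIV_nonneg_imp_le:
  fixes f f' :: "real \<Rightarrow> real"
  assumes "\<And>s. a \<le> s \<Longrightarrow> (f has_real_derivative f' s) (at s)"
    and "\<And>s. a \<le> s \<Longrightarrow> f' s \<ge> 0" "a \<le> x" "x \<le> y"
  shows "f x \<le> f y"
proof (rule DERIV_nonneg_imp_nondecreasing[OF \<open>x \<le> y\<close>])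
  show "\<exists>d. (f has_real_derivative d) (at s) \<and> 0 \<le> d" if "x \<le> s" for s
    using assms(1,2)[of s] \<open>a \<le> x\<close> that by auto
qed

lemma DERIV_nonpos_imp_ge:
  fixes f f' :: "real \<Rightarrow> real"
  assumes "\<And>s. a \<le> s \<Longrightarrow> (f has_real_derivative f' s) (at s)"
    and "\<And>s. a \<le> s \<Longrightarrow> f' s \<le> 0" "a \<le> x" "x \<le> y"
  shows "f y \<le> f x"
proof (rule DERIV_nonpos_imp_nonincreasing[OF \<open>x \<le> y\<close>])
  show "\<exists>d. (f has_real_derivative d) (at s) \<and> d \<le> 0" if "x \<le> s" for s
    using assms(1,2)[of s] \<open>a \<le> x\<close> that by auto
qed

text \<open>The sign of \<open>f'\<close> is known only while \<open>f > 0\<close>, but up to the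
  first zero that is enough: \<open>f\<close> is nondecreasing there and cannot come down to
  0.\<close>

lemma stays_positive:
  fixes f f' :: "real \<Rightarrow> real"
  assumes der: "\<And>s. a \<le> s \<Longrightarrow> (f has_real_derivative f' s) (at s)"
    and pos: "\<And>s. a \<le> s \<Longrightarrow> f s > 0 \<Longrightarrow> f' s \<ge> 0"
    and "f a > 0" "a \<le> b"
  shows "f b > 0"
proof (rule ccontr)
  assume "\<not> f b > 0"
  then obtain t where t: "a < t" "t \<le> b" "f t = 0" "\<And>s. a \<le> s \<Longrightarrow> s < t \<Longrightarrow> f s > 0"
    using first_exit[OF continuous_on_from_DERIV[OF der] \<open>a \<le> b\<close> \<open>f a > 0\<close>] by auto
  have "f a \<le> f t"
  proof (rule DERIV_nonneg_imp_increasing_open[OF less_imp_le[OF t(1)]])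
    show "\<exists>y. (f has_real_derivative y) (at x) \<and> 0 \<le> y" if "a < x" "x < t" for x
      using der[of x] pos[of x] t(4)[of x] that by auto
  qed (rule continuous_on_from_DERIV[OF der])
  with t assms show False by simp
qed

text \<open>Time reversal turns \<open>first_exit\<close> into a last entrance: after the last time
  at level \<open>e\<close> before \<open>b\<close>, the function lies above \<open>e\<close> and
  hence cannot rise.\<close>

lemma stays_below:
  fixes f f' :: "real \<Rightarrow> real"
  assumes der: "\<And>s. a \<le> s \<Longrightarrow> (f has_real_derivative f' s) (at s)"
    and neg: "\<And>s. a \<le> s \<Longrightarrow> f s > e \<Longrightarrow> f' s \<le> 0"
    and "f a \<le> e" "a \<le> b"
  shows "f b \<le> e"
proof (rule ccontr)
  assume *: "\<not> f b \<le> e"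
  have cont: "continuous_on {-b..-a} (\<lambda>s. f (-s) - e)"
    by (intro continuous_intros continuous_on_compose2[OF continuous_on_from_DERIV[OF der]]) auto
  obtain t where t: "-b < t" "t \<le> -a" "f (-t) - e = 0"
      "\<And>s. -b \<le> s \<Longrightarrow> s < t \<Longrightarrow> f (-s) - e > 0"
    using first_exit[OF cont] assms * by auto
  have "f b \<le> f (-t)"
  proof (rule DERIV_nonpos_imp_decreasing_open[of "-t" b])
    show "\<exists>y. (f has_real_derivative y) (at x) \<and> y \<le> 0" if "-t < x" "x < b" for x
      using der[of x] neg[of x] t(2) t(4)[of "-x"] that by auto
    show "continuous_on {-t..b} f"
      by (rule continuous_on_subset[OF continuous_on_from_DERIV[OF der]]) (use t in auto)
  qed (use t in auto)
  with t * show False by simp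
qed

text \<open>Drift at speed \<open>d\<close> brings \<open>f\<close> from \<open>f a\<close> down to
  \<open>e\<close> within time \<open>(f a - e) / d\<close>; afterwards \<open>stays_below\<close>
  holds it there.\<close>

lemma eventually_below:
  fixes f f' :: "real \<Rightarrow> real"
  assumes der: "\<And>s. a \<le> s \<Longrightarrow> (f has_real_derivative f' s) (at s)"
    and neg: "\<And>s. a \<le> s \<Longrightarrow> f s > e \<Longrightarrow> f' s \<le> -d" and "d > 0"
  shows "eventually (\<lambda>s. f s \<le> e) at_top"
proof -
  have "\<exists>b\<ge>a. f b \<le> e"
  proof (rule ccontr)
    assume "\<not> (\<exists>b\<ge>a. f b \<le> e)"
    then have gt: "f s > e" if "s \<ge> a" for s using that by force
    define b where "b = a + (f a - e) / d"
    have ab: "a \<le> b" using gt[of a] \<open>d > 0\<close> by (simp add: b_def)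
    have "f b + d * b \<le> f a + d * a"
    proof (rule DERIV_nonpos_imp_ge[where a=a and f="\<lambda>s. f s + d * s" and f'="\<lambda>s. f' s + d"])
      show "((\<lambda>s. f s + d * s) has_real_derivative f' s + d) (at s)" if "a \<le> s" for s
        using der[OF that] by (auto intro!: derivative_eq_intros)
      show "f' s + d \<le> 0" if "a \<le> s" for s using neg[OF that gt[OF that]] by simp
    qed (use ab in auto)
    then have "f b \<le> e" using \<open>d > 0\<close> by (simp add: b_def field_simps)
    with gt[OF ab] show False by simp
  qed
  then obtain b where b: "b \<ge> a" "f b \<le> e" by blast
  have "f s \<le> e" if "s \<ge> b" for s
  proof (rule stays_below[where a=b and f=f and f'=f' and e=e])
    show "f' s \<le> 0" if "b \<le> s" "f s > e" for s using neg[of s] that b \<open>d > 0\<close> by auto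
  qed (use der b that in auto)
  then show ?thesis by (auto simp: eventually_at_top_linorder)
qed

text \<open>Outside the band \<open>\<bar>x\<bar> \<le> e / 2\<close> the restoring term beats
  \<open>g\<close>, which gives a uniform drift back into the band. The rate \<open>\<beta>\<close>
  may depend on \<open>x\<close>, so Riccati equations are covered.\<close>

lemma damped_tendsto_0:
  fixes x x' g \<beta> :: "real \<Rightarrow> real"
  assumes der: "\<And>s. a \<le> s \<Longrightarrow> (x has_real_derivative x' s) (at s)"
    and eq: "\<And>s. a \<le> s \<Longrightarrow> x' s = g s - \<beta> s * x s"
    and \<beta>: "\<And>s. a \<le> s \<Longrightarrow> \<beta> s \<ge> k" and "k > 0"
    and g: "(g \<longlongrightarrow> 0) at_top"
  shows "(x \<longlongrightarrow> 0) at_top"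
proof (rule tendstoI)
  fix e :: real assume "e > 0"
  \<comment> \<open>\<open>2 * d\<close> is the least restoring force outside the band; half of it
    absorbs \<open>g\<close>, the other half is the drift.\<close>
  define d where "d = k * (e/2) / 2"
  have "d > 0" using \<open>k > 0\<close> \<open>e > 0\<close> by (simp add: d_def)
  from tendstoD[OF g this] obtain b where b: "\<And>s. s \<ge> b \<Longrightarrow> \<bar>g s\<bar> < d"
    unfolding eventually_at_top_linorder by auto
  define m where "m = max a b"
  have drift: "x' s \<le> - d" if "s \<ge> m" "x s > e/2" for s
  proof -
    have "k * (e/2) \<le> \<beta> s * x s"
      using \<beta>[of s] that \<open>k > 0\<close> \<open>e > 0\<close> by (intro mult_mono) (auto simp: m_def)
    then show ?thesis using b[of s] eq[of s] that by (auto simp: m_def d_def)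
  qed
  have drift': "- x' s \<le> - d" if "s \<ge> m" "- x s > e/2" for s
  proof -
    have "k * (e/2) \<le> \<beta> s * (- x s)"
      using \<beta>[of s] that \<open>k > 0\<close> \<open>e > 0\<close> by (intro mult_mono) (auto simp: m_def)
    then show ?thesis using b[of s] eq[of s] that by (auto simp: m_def d_def)
  qed
  have "eventually (\<lambda>s. x s \<le> e/2) at_top"
    by (rule eventually_below[where a=m and f'=x' and d=d]) (use der drift \<open>d > 0\<close> in \<open>auto simp: m_def\<close>)
  moreover have "eventually (\<lambda>s. - x s \<le> e/2) at_top"
    by (rule eventually_below[where a=m and f'="\<lambda>s. - x' s" and d=d])
       (use der drift' \<open>d > 0\<close> in \<open>auto simp: m_def intro!: derivative_intros\<close>)
  ultimately show "eventually (\<lambda>s. dist (x s) 0 < e) at_top"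
    by eventually_elim (use \<open>e > 0\<close> in auto)
qed

text \<open>On a short window the small increment of \<open>f\<close> forces \<open>g\<close> to be
  small somewhere, and the bound on \<open>h\<close> carries this smallness back to the left end of
  the window.\<close>

lemma barbalat:
  fixes f g h :: "real \<Rightarrow> real"
  assumes f: "\<And>s. a \<le> s \<Longrightarrow> (f has_real_derivative g s) (at s)"
    and g: "\<And>s. a \<le> s \<Longrightarrow> (g has_real_derivative h s) (at s)"
    and h: "\<And>s. a \<le> s \<Longrightarrow> \<bar>h s\<bar> \<le> C"
    and lim: "(f \<longlongrightarrow> l) at_top"
  shows "(g \<longlongrightarrow> 0) at_top"
proof (rule tendstoI)
  fix e :: real assume "e > 0"
  have "C \<ge> 0" using h[of a] by simp
  define d where "d = e / (2 * (C + 1))"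
  have "d > 0" using \<open>e > 0\<close> \<open>C \<ge> 0\<close> by (simp add: d_def)
  have Cd: "C * d \<le> e / 2" using \<open>e > 0\<close> \<open>C \<ge> 0\<close> by (simp add: d_def field_simps)
  have "d * e / 4 > 0" using \<open>d > 0\<close> \<open>e > 0\<close> by simp
  from tendstoD[OF lim this] obtain b where b: "\<And>s. s \<ge> b \<Longrightarrow> \<bar>f s - l\<bar> < d * e / 4"
    unfolding eventually_at_top_linorder dist_real_def by auto
  have "\<bar>g s\<bar> < e" if s: "s \<ge> max a b" for s
  proof -
    obtain z where z: "s < z" "z < s + d" "f (s + d) - f s = (s + d - s) * g z"
      using MVT2[of s "s+d" f g] f s \<open>d > 0\<close> by auto
    obtain y where y: "s < y" "y < z" "g z - g s = (z - s) * h y"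
      using MVT2[of s z g h] g s z by auto
    have "\<bar>g z - g s\<bar> \<le> d * C"
      unfolding y(3) abs_mult using h[of y] y z s by (intro mult_mono) auto
    moreover have "\<bar>f (s + d) - f s\<bar> < d * e / 2"
      using b[of s] b[of "s+d"] s \<open>d > 0\<close> by linarith
    then have "\<bar>d * g z\<bar> < d * (e / 2)" using z(3) by simp
    then have "\<bar>g z\<bar> < e / 2" using \<open>d > 0\<close> by (simp add: abs_mult)
    ultimately show ?thesis using Cd by (simp add: mult.commute)
  qed
  then show "eventually (\<lambda>s. dist (g s) 0 < e) at_top"
    unfolding eventually_at_top_linorder by (intro exI[of _ "max a b"]) auto
qed

lemma antimono_bdd_below_convergent_at_top:
  fixes f :: "real \<Rightarrow> real"
  assumes anti: "\<And>x y. a \<le> x \<Longrightarrow> x \<le> y \<Longrightarrow> f y \<le> f x" and bdd: "\<And>x. a \<le> x \<Longrightarrow> B \<le> f x"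
  shows "\<exists>l. (f \<longlongrightarrow> l) at_top"
proof -
  define l where "l = (INF x\<in>{a..}. f x)"
  have bb: "bdd_below (f ` {a..})" using bdd by (auto intro!: bdd_belowI[of _ B])
  have "(f \<longlongrightarrow> l) at_top"
  proof (rule tendstoI)
    fix e :: real assume "e > 0"
    then obtain b where b: "b \<ge> a" "f b < l + e"
      using cINF_less_iff[of "{a..}" f "l+e"] bb by (auto simp: l_def)
    have "dist (f x) l < e" if "x \<ge> b" for x
      using anti[of b x] b that cINF_lower[OF bb, of x] \<open>e > 0\<close> by (auto simp: l_def dist_real_def)
    then show "eventually (\<lambda>x. dist (f x) l < e) at_top"
      unfolding eventually_at_top_linorder by auto
  qed
  then show ?thesis by blast
qed

subsection \<open>Global solutions of initial value problems\<close>

text \<open>The contraction is \<open>x \<mapsto> x0 + \<integral>F s (x s)\<close>, written for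
  \<open>y t = x t / exp (2 \<Lambda> t)\<close>; this weight makes it globally a contraction with constant 1/2.\<close>

lemma global_ivp_half_line:
  fixes F :: "real \<Rightarrow> 'a::banach \<Rightarrow> 'a" and x0 :: 'a
  assumes cont: "\<And>x. continuous_on {0..} x \<Longrightarrow> continuous_on {0..} (\<lambda>t. F t (x t))"
    and lip: "\<And>t x y. t \<ge> 0 \<Longrightarrow> norm (F t x - F t y) \<le> l t * norm (x - y)"
    and bnd: "\<And>t. t \<ge> 0 \<Longrightarrow> norm (F t 0) \<le> l t * C"
    and \<Lambda>: "\<And>t. (\<Lambda> has_real_derivative l t) (at t)"
    and l0: "\<And>t. l t \<ge> 0" and "\<Lambda> 0 = 0"
  shows "\<exists>x. x 0 = x0 \<and> (\<forall>t\<ge>0. (x has_vector_derivative F t (x t)) (at t within {0..}))"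
proof -
  \<comment> \<open>Since \<open>w' = 2 * (l * w)\<close>, the integral of \<open>l * w\<close> is
    at most \<open>w / 2\<close>; this produces the contraction constant.\<close>
  define w where "w t = exp (2 * \<Lambda> t)" for t
  have w_der: "(w has_real_derivative 2 * (l t * w t)) (at t)" for t
    unfolding w_def by (rule derivative_eq_intros \<Lambda> refl | simp)+
  have wc: "continuous_on S w" for S
    by (rule DERIV_continuous_on, rule has_field_derivative_at_within, rule w_der)
  have \<Lambda>_mono: "\<Lambda> s \<le> \<Lambda> t" if "s \<le> t" for s t
    using \<Lambda> l0 that by (intro DERIV_nonneg_imp_nondecreasing[of s t \<Lambda>]) auto
  have w1: "w t \<ge> 1" if "t \<ge> 0" for t
    using \<Lambda>_mono[OF that] \<open>\<Lambda> 0 = 0\<close> by (simp add: w_def)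
  have w_pos: "w t > 0" for t by (simp add: w_def)
  have w_int: "((\<lambda>s. l s * w s) has_integral (w t - w 0) / 2) {0..t}" if "t \<ge> 0" for t
  proof -
    have "((\<lambda>s. 2 * (l s * w s)) has_integral w t - w 0) {0..t}"
      using fundamental_theorem_of_calculus[OF that, of w "\<lambda>s. 2 * (l s * w s)"] w_der
      by (metis has_real_derivative_iff_has_vector_derivative has_vector_derivative_at_within)
    then show ?thesis
      using has_integral_mult_right[of "\<lambda>s. 2 * (l s * w s)" "w t - w 0" "{0..t}" "1/2"] by simp
  qed
  define J where "J y t = integral {0..t} (\<lambda>s. F s (w s *\<^sub>R y s))" for y :: "real \<Rightarrow> 'a" and t
  \<comment> \<open>\<open>max 0 t\<close> extends the iterate constantly to negative times, so that
    it lives in the complete space of bounded continuous functions on the whole line.\<close>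
  define T0 where "T0 y t = (1 / w (max 0 t)) *\<^sub>R (x0 + J y (max 0 t))" for y t
  have Fc: "continuous_on {0..} (\<lambda>s. F s (w s *\<^sub>R y s))" if "continuous_on UNIV y" for y
    by (rule cont) (intro continuous_intros wc continuous_on_subset[OF that], auto)
  have Fi: "(\<lambda>s. F s (w s *\<^sub>R y s)) integrable_on {0..t}" if "continuous_on UNIV y" for y t
    by (rule integrable_continuous_real, rule continuous_on_subset[OF Fc[OF that]]) auto
  have Fgrow: "norm (F s x) \<le> l s * (C + norm x)" if "s \<ge> 0" for s x
  proof -
    have "norm (F s x) \<le> norm (F s 0) + norm (F s x - F s 0)"
      by (metis add.commute norm_triangle_sub)
    then show ?thesis using lip[OF that, of x 0] bnd[OF that] by (simp add: algebra_simps)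
  qed
  have J_der: "(J y has_vector_derivative F t (w t *\<^sub>R y t)) (at t within {0..})"
    if y: "continuous_on UNIV y" and "t \<ge> 0" for y t
  proof -
    have "((\<lambda>u. integral {0..u} (\<lambda>s. F s (w s *\<^sub>R y s))) has_vector_derivative F t (w t *\<^sub>R y t))
        (at t within {0..t+1})"
      by (rule integral_has_vector_derivative, rule continuous_on_subset[OF Fc[OF y]]) (use that in auto)
    then have "(J y has_vector_derivative F t (w t *\<^sub>R y t)) (at t within {0..t+1})"
      unfolding J_def .
    moreover have "at t within {0..} = at t within {0..t+1}"
      by (rule at_within_nhd[of _ "{t-1<..<t+1}"]) (use that in auto)
    ultimately show ?thesis by simp
  qed
  have Jc: "continuous_on {0..} (J y)" if y: "continuous_on UNIV y" for y
    unfolding continuous_on_eq_continuous_within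
    using has_vector_derivative_continuous[OF J_der[OF y]] by auto
  have Tc: "continuous_on UNIV (T0 y)" if y: "continuous_on UNIV y" for y
    unfolding T0_def
    by (intro continuous_intros continuous_on_compose2[OF wc] continuous_on_compose2[OF Jc[OF y]])
       (use w_pos in \<open>auto simp: less_imp_neq[symmetric]\<close>)
  \<comment> \<open>Stated for continuous arguments at bounded distance, this serves twice: with
    \<open>z = 0\<close> it shows that the map preserves boundedness, and with the distance of two
    bounded functions it is the contraction estimate.\<close>
  have diff: "norm (T0 y t - T0 z t) \<le> 1/2 * K"
    if y: "continuous_on UNIV y" and z: "continuous_on UNIV z" and K: "\<And>s. norm (y s - z s) \<le> K" for y z t K
  proof -
    define m where "m = max 0 t"
    have m: "m \<ge> 0" by (simp add: m_def)
    have K0: "K \<ge> 0" using K[of 0] norm_ge_zero order_trans by blast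
    have "J y m - J z m = integral {0..m} (\<lambda>s. F s (w s *\<^sub>R y s) - F s (w s *\<^sub>R z s))"
      unfolding J_def by (rule integral_diff[symmetric]) (rule Fi y z)+
    also have "norm \<dots> \<le> integral {0..m} (\<lambda>s. K * (l s * w s))"
    proof (rule integral_norm_bound_integral)
      show "(\<lambda>s. F s (w s *\<^sub>R y s) - F s (w s *\<^sub>R z s)) integrable_on {0..m}"
        by (rule integrable_diff) (rule Fi y z)+
      show "(\<lambda>s. K * (l s * w s)) integrable_on {0..m}"
        using w_int[OF m] by (intro integrable_on_mult_right) auto
      fix s assume "s \<in> {0..m}"
      then have "norm (F s (w s *\<^sub>R y s) - F s (w s *\<^sub>R z s)) \<le> l s * norm (w s *\<^sub>R y s - w s *\<^sub>R z s)"
        using lip by simp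
      also have "\<dots> = l s * (w s * norm (y s - z s))"
        using w_pos[of s] by (simp add: scaleR_diff_right[symmetric])
      also have "\<dots> \<le> l s * (w s * K)"
        using K[of s] l0[of s] w_pos[of s] by (intro mult_left_mono) auto
      finally show "norm (F s (w s *\<^sub>R y s) - F s (w s *\<^sub>R z s)) \<le> K * (l s * w s)"
        by (simp add: algebra_simps)
    qed
    also have "\<dots> = K * ((w m - w 0) / 2)"
      using has_integral_mult_right[OF w_int[OF m], of K] by (rule integral_unique)
    also have "\<dots> \<le> K * (w m / 2)"
      using K0 w_pos[of 0] by (intro mult_left_mono) auto
    finally have "norm (J y m - J z m) \<le> K * (w m / 2)" .
    then have "norm (J y m - J z m) / w m \<le> 1/2 * K"
      using w_pos[of m] by (simp add: field_simps)
    moreover have "T0 y t - T0 z t = (1 / w m) *\<^sub>R (J y m - J z m)"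
      by (simp add: T0_def m_def scaleR_diff_right[symmetric])
    ultimately show ?thesis using w_pos[of m] by simp
  qed
  have T00: "norm (T0 (\<lambda>_. 0) t) \<le> norm x0 + \<bar>C\<bar>" for t
  proof -
    define m where "m = max 0 t"
    have m: "m \<ge> 0" by (simp add: m_def)
    have "norm (J (\<lambda>_. 0) m) \<le> integral {0..m} (\<lambda>s. \<bar>C\<bar> * (l s * w s))"
      unfolding J_def
    proof (rule integral_norm_bound_integral)
      show "(\<lambda>s. F s (w s *\<^sub>R 0)) integrable_on {0..m}" using Fi[of "\<lambda>_. 0" m] by simp
      show "(\<lambda>s. \<bar>C\<bar> * (l s * w s)) integrable_on {0..m}"
        using w_int[OF m] by (intro integrable_on_mult_right) auto
      fix s assume s: "s \<in> {0..m}"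
      have "norm (F s 0) \<le> l s * C" using bnd s by simp
      also have "\<dots> \<le> l s * (\<bar>C\<bar> * w s)"
      proof (rule mult_left_mono)
        have "C \<le> \<bar>C\<bar> * 1" by simp
        also have "\<dots> \<le> \<bar>C\<bar> * w s" using w1[of s] s by (intro mult_left_mono) auto
        finally show "C \<le> \<bar>C\<bar> * w s" .
      qed (rule l0)
      finally show "norm (F s (w s *\<^sub>R 0)) \<le> \<bar>C\<bar> * (l s * w s)" by (simp add: algebra_simps)
    qed
    also have "\<dots> = \<bar>C\<bar> * ((w m - w 0) / 2)"
      using has_integral_mult_right[OF w_int[OF m], of "\<bar>C\<bar>"] by (rule integral_unique)
    also have "\<dots> \<le> \<bar>C\<bar> * w m"
      using w_pos[of 0] w_pos[of m] by (intro mult_left_mono) auto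
    finally have "norm (x0 + J (\<lambda>_. 0) m) \<le> norm x0 * w m + \<bar>C\<bar> * w m"
      using norm_triangle_ineq[of x0 "J (\<lambda>_. 0) m"] mult_left_mono[OF w1[OF m], of "norm x0"] by simp
    then have "norm (x0 + J (\<lambda>_. 0) m) / w m \<le> norm x0 + \<bar>C\<bar>"
      using w_pos[of m] by (simp add: field_simps)
    then show ?thesis using w_pos[of m] by (simp add: T0_def m_def)
  qed
  have Tb: "T0 y \<in> bcontfun" if "y \<in> bcontfun" for y
  proof -
    have y: "continuous_on UNIV y" "bounded (range y)" using that by (auto simp: bcontfun_def)
    obtain K where K: "\<And>s. norm (y s) \<le> K" using y(2) by (auto simp: bounded_iff)
    have "norm (T0 y t) \<le> 1/2 * K + (norm x0 + \<bar>C\<bar>)" for t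
      using diff[OF y(1), of "\<lambda>_. 0" K t] K T00[of t] norm_triangle_sub[of "T0 y t" "T0 (\<lambda>_. 0) t"]
      by simp
    then show ?thesis by (rule bcontfun_normI[OF Tc[OF y(1)]])
  qed
  define T where "T y = Bcontfun (T0 (apply_bcontfun y))" for y
  have T: "apply_bcontfun (T y) = T0 (apply_bcontfun y)" for y
    unfolding T_def by (rule Bcontfun_inverse) (rule Tb, rule apply_bcontfun)
  have "\<exists>!y. T y = y"
  proof (rule banach_fix_type[of "1/2"])
    show "\<forall>y z. dist (T y) (T z) \<le> 1/2 * dist y z"
    proof (intro allI dist_bound)
      fix y z :: "real \<Rightarrow>\<^sub>C 'a" and t
      have "norm (y s - z s) \<le> dist y z" for s using dist_bounded[of y s z] by (simp add: dist_norm)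
      then show "dist (T y t) (T z t) \<le> 1/2 * dist y z"
        unfolding T dist_norm by (intro diff) auto
    qed
  qed auto
  then obtain yb where "T yb = yb" by blast
  define y where "y = apply_bcontfun yb"
  have yc: "continuous_on UNIV y" by (simp add: y_def)
  have yT: "T0 y = y" using T[of yb] \<open>T yb = yb\<close> by (simp add: y_def)
  define x where "x t = w t *\<^sub>R y t" for t
  have x: "x t = x0 + J y t" if "t \<ge> 0" for t
  proof -
    have "x t = w t *\<^sub>R T0 y t" unfolding yT x_def ..
    also have "\<dots> = x0 + J y t" using that w_pos[of t] by (simp add: T0_def max_def)
    finally show ?thesis .
  qed
  have "x 0 = x0" using x[of 0] by (simp add: J_def)
  moreover have "(x has_vector_derivative F t (x t)) (at t within {0..})" if "t \<ge> 0" for t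
  proof -
    have "((\<lambda>t. x0 + J y t) has_vector_derivative 0 + F t (w t *\<^sub>R y t)) (at t within {0..})"
      by (intro has_vector_derivative_add has_vector_derivative_const J_der yc that)
    then have "((\<lambda>t. x0 + J y t) has_vector_derivative F t (x t)) (at t within {0..})"
      by (simp add: x_def)
    then show ?thesis
      by (rule has_vector_derivative_transform[rotated 2]) (use x that in auto)
  qed
  ultimately show ?thesis by blast
qed

text \<open>The equation is read as a first-order system for \<open>(v, w)\<close>. A damping of
  size \<open>exp (2 * t)\<close> must be allowed because it contains \<open>r\<^sup>2\<close>; this
  is why the Lipschitz constant above depends on time.\<close>

lemma damped_ivp_half_line:
  fixes d g :: "real \<Rightarrow> real" and v0 w0 K :: real
  assumes d: "continuous_on {0..} d" "\<And>t. t \<ge> 0 \<Longrightarrow> \<bar>d t\<bar> \<le> K * exp (2 * t)"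
    and g: "\<And>x y. \<bar>g x - g y\<bar> \<le> K * \<bar>x - y\<bar>"
  obtains v w :: "real \<Rightarrow> real" where "v 0 = v0" "w 0 = w0"
    "\<And>t. t \<ge> 0 \<Longrightarrow> (v has_real_derivative w t) (at t within {0..})"
    "\<And>t. t \<ge> 0 \<Longrightarrow> (w has_real_derivative - d t * w t + g (v t)) (at t within {0..})"
proof -
  have K: "K \<ge> 0" using g[of 1 0] by simp
  define F where "F t z = (snd z, - d t * snd z + g (fst z))" for t and z :: "real \<times> real"
  \<comment> \<open>The 1 accounts for \<open>v' = w\<close>, one \<open>K\<close> for the damping
    and one for \<open>g\<close>.\<close>
  define l where "l t = (1 + 2 * K) * exp (2 * t)" for t :: real
  define \<Lambda> where "\<Lambda> t = (1 + 2 * K) * ((exp (2 * t) - 1) / 2)" for t :: real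
  have gc: "continuous_on UNIV g"
  proof (rule lipschitz_on_continuous_on)
    show "K-lipschitz_on UNIV g" using g K by (auto simp: lipschitz_on_def dist_real_def)
  qed
  have e1: "exp (2 * t) \<ge> 1" if "t \<ge> 0" for t :: real using that by simp
  have "\<exists>x. x 0 = (v0, w0) \<and> (\<forall>t\<ge>0. (x has_vector_derivative F t (x t)) (at t within {0..}))"
  proof (rule global_ivp_half_line[where l=l and \<Lambda>=\<Lambda> and C="\<bar>g 0\<bar>"])
    show "continuous_on {0..} (\<lambda>t. F t (x t))" if "continuous_on {0..} x" for x
      unfolding F_def by (intro continuous_intros d that continuous_on_compose2[OF gc]) auto
    show "norm (F t x - F t y) \<le> l t * norm (x - y)" if t: "t \<ge> 0" for t x y
    proof -
      define a b where "a = fst x - fst y" and "b = snd x - snd y"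
      have ab: "\<bar>a\<bar> \<le> norm (x - y)" "\<bar>b\<bar> \<le> norm (x - y)"
        using norm_fst_le[of a b] norm_snd_le[of b a] by (auto simp: a_def b_def minus_prod_def)
      have "F t x - F t y = (b, - d t * b + (g (fst x) - g (fst y)))"
        by (simp add: F_def b_def algebra_simps)
      then have "norm (F t x - F t y) \<le> \<bar>b\<bar> + \<bar>- d t * b + (g (fst x) - g (fst y))\<bar>"
        by (metis norm_Pair_le real_norm_def)
      also have "\<dots> \<le> \<bar>b\<bar> + (\<bar>d t\<bar> * \<bar>b\<bar> + K * \<bar>a\<bar>)"
        using g[of "fst x" "fst y"] abs_triangle_ineq[of "- d t * b" "g (fst x) - g (fst y)"]
        by (simp add: abs_mult a_def)
      also have "\<dots> \<le> exp (2*t) * norm (x - y) + (K * exp (2*t) * norm (x - y) + K * exp (2*t) * norm (x - y))"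
      proof (intro add_mono)
        show "\<bar>b\<bar> \<le> exp (2*t) * norm (x - y)"
          using mult_mono[OF e1[OF t] ab(2)] by simp
        show "\<bar>d t\<bar> * \<bar>b\<bar> \<le> K * exp (2*t) * norm (x - y)"
          using d(2)[OF t] ab(2) K by (intro mult_mono) auto
        have "K * \<bar>a\<bar> \<le> K * (exp (2*t) * norm (x - y))"
          using mult_mono[OF e1[OF t] ab(1)] K by (intro mult_left_mono) auto
        then show "K * \<bar>a\<bar> \<le> K * exp (2*t) * norm (x - y)" by (simp add: mult.assoc)
      qed
      finally show ?thesis by (simp add: l_def algebra_simps)
    qed
    show "norm (F t 0) \<le> l t * \<bar>g 0\<bar>" if "t \<ge> 0" for t
    proof -
      have "1 \<le> l t" unfolding l_def using e1[OF that] K mult_mono[of 1 "1 + 2*K" 1 "exp (2*t)"] by simp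
      then show ?thesis using mult_right_mono[of 1 "l t" "\<bar>g 0\<bar>"] by (simp add: F_def)
    qed
    show "(\<Lambda> has_real_derivative l t) (at t)" for t
      unfolding \<Lambda>_def l_def by (auto intro!: derivative_eq_intros)
  qed (use K in \<open>auto simp: l_def \<Lambda>_def\<close>)
  then obtain x where x: "x 0 = (v0, w0)"
    "\<And>t. t \<ge> 0 \<Longrightarrow> (x has_vector_derivative F t (x t)) (at t within {0..})" by blast
  show ?thesis
  proof (rule that[of "\<lambda>t. fst (x t)" "\<lambda>t. snd (x t)"])
    fix t :: real assume "t \<ge> 0"
    from x(2)[OF this] show "((\<lambda>t. fst (x t)) has_real_derivative snd (x t)) (at t within {0..})"
      "((\<lambda>t. snd (x t)) has_real_derivative - d t * snd (x t) + g (fst (x t))) (at t within {0..})"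
      using bounded_linear.has_vector_derivative[OF bounded_linear_fst]
        bounded_linear.has_vector_derivative[OF bounded_linear_snd]
      by (force simp: F_def has_real_derivative_iff_has_vector_derivative)+
  qed (use x(1) in auto)
qed

subsection \<open>Behaviour of singular solutions near the origin\<close>

text \<open>In the variable \<open>s = - ln r\<close> the equation \<open>(E)\<close> for \<open>U s = u (exp (-s))\<close> is
  a first-order system for \<open>U\<close> and \<open>Q = U'\<close>; here \<open>n = N - 2\<close> and \<open>a = 2 / (p - 1)\<close>.\<close>

locale singular_flow =
  fixes n p a :: real and U Q :: "real \<Rightarrow> real"
  assumes n: "n \<ge> 1" and p: "p > 1" and ap: "a * (p - 1) = 2" and an: "a \<le> n" "n < 2 * a"
    and U_pos: "\<And>s. U s > 0"
    and U_der: "\<And>s. (U has_real_derivative Q s) (at s)"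
    and Q_der: "\<And>s. (Q has_real_derivative
      (n + exp (-2 * s) / 2) * Q s - exp (-2 * s) * (a / 2 * U s + U s powr p)) (at s)"
    and U_top: "filterlim U at_top at_top"
begin

definition "b = 2 * a - n"
definition "c = a * (n - a)"
definition "v s = exp (- (a * s)) * U s"
definition "v1 s = exp (- (a * s)) * (Q s - a * U s)"
definition "damp s = b - exp (-2 * s) / 2"
text \<open>The equation for \<open>Q\<close> becomes formally linear with \<open>\<epsilon>\<close>
  as the coefficient of \<open>- U\<close> (\<open>Q_der'\<close>). It is small near the origin as
  soon as \<open>v\<close> is, which makes comparison of \<open>Q\<close> with multiples of
  \<open>U\<close> possible.\<close>

definition "\<epsilon> s = exp (-2 * s) * a / 2 + v s powr (p - 1)"

lemma a_pos: "a > 0" using n an by simp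
lemma b_pos: "b > 0" using an by (simp add: b_def)
lemma c_nonneg: "c \<ge> 0" using an a_pos by (simp add: c_def)
lemma v_pos: "v s > 0" using U_pos by (simp add: v_def)

lemma powr_p: "x powr p = x * x powr (p - 1)" if "x \<ge> 0" for x :: real
  using that by (cases "x = 0") (auto simp: powr_mult_base)

lemma v_powr: "v s powr (p - 1) = exp (-2 * s) * U s powr (p - 1)"
proof -
  have "- (a * s) * (p - 1) = -2 * s" unfolding ap[symmetric] by (simp add: algebra_simps)
  then have "exp (- (a * s)) powr (p - 1) = exp (-2 * s)" by (simp only: exp_powr_real)
  then show ?thesis using U_pos[of s] by (simp add: v_def powr_mult)
qed

lemma v_powr_p: "v s powr p = exp (- (a * s)) * (exp (-2 * s) * U s powr p)"
  using v_powr[of s] v_pos[of s] U_pos[of s] powr_p[of "v s"] powr_p[of "U s"]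
  by (simp add: v_def)

lemma v_der: "(v has_real_derivative v1 s) (at s)"
  unfolding v_def[abs_def] v1_def
  by (rule derivative_eq_intros U_der refl | simp)+ (simp add: algebra_simps)

lemma Q_v: "exp (- (a * s)) * Q s = v1 s + a * v s"
  by (simp add: v_def v1_def algebra_simps)

lemma v1_der: "(v1 has_real_derivative - damp s * v1 s + c * v s - v s powr p) (at s)"
proof -
  have "(v1 has_real_derivative - a * v1 s + ((n + exp (-2 * s) / 2) * (exp (- (a * s)) * Q s)
      - exp (-2 * s) * (a / 2 * v s) - exp (- (a * s)) * (exp (-2 * s) * U s powr p) - a * (exp (- (a * s)) * Q s))) (at s)"
    unfolding v1_def[abs_def] v_def
    by (rule derivative_eq_intros U_der Q_der refl | simp)+ (simp add: algebra_simps)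
  then show ?thesis
    unfolding Q_v v_powr_p[symmetric] by (simp add: damp_def b_def c_def algebra_simps)
qed

lemma Q_der': "(Q has_real_derivative (n + exp (-2 * s) / 2) * Q s - \<epsilon> s * U s) (at s)"
proof -
  have "exp (-2 * s) * U s powr p = v s powr (p - 1) * U s"
    using v_powr[of s] powr_p[of "U s"] U_pos[of s] by simp
  then show ?thesis using Q_der[of s] by (simp add: \<epsilon>_def algebra_simps)
qed

lemma eps_pos: "\<epsilon> s > 0"
  using a_pos v_pos[of s] by (auto simp: \<epsilon>_def intro!: add_nonneg_pos)

lemma exp_m2: "((\<lambda>s::real. exp (-2 * s)) \<longlongrightarrow> 0) at_top"
  by (rule filterlim_compose[OF exp_at_bot])
     (rule filterlim_tendsto_neg_mult_at_bot[OF tendsto_const _ filterlim_ident], simp)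

text \<open>With an integrating factor \<open>Q\<close> is nonincreasing, because
  \<open>\<epsilon> * U > 0\<close>. Once \<open>Q \<le> 0\<close>, it remains so and
  \<open>U\<close> stays bounded, against \<open>U_top\<close>. Thus a singular solution decreases
  strictly in \<open>r\<close>.\<close>

lemma Q_pos: "Q s > 0"
proof (rule ccontr)
  assume "\<not> Q s > 0"
  then have s: "Q s \<le> 0" by simp
  have "- Q t \<ge> 0" if "t \<ge> s" for t
  proof -
    define m where "m t = exp (exp (-2*t) / 4 - n * t)" for t
    have "Q t * m t \<le> Q s * m s"
    proof (rule DERIV_nonpos_imp_ge[where a=s and f="\<lambda>t. Q t * m t" and f'="\<lambda>t. - \<epsilon> t * U t * m t"])
      show "((\<lambda>t. Q t * m t) has_real_derivative - \<epsilon> t * U t * m t) (at t)" for t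
        unfolding m_def by (rule derivative_eq_intros Q_der' refl | simp)+ (simp add: algebra_simps)
      show "- \<epsilon> t * U t * m t \<le> 0" for t
        using eps_pos[of t] U_pos[of t] by (simp add: m_def)
    qed (use that in auto)
    also have "\<dots> \<le> 0" using s by (simp add: m_def mult_nonpos_nonneg)
    finally show ?thesis by (simp add: m_def mult_le_0_iff)
  qed
  then have "U t \<le> U s" if "t \<ge> s" for t
    using DERIV_nonpos_imp_ge[OF U_der, of s s t] that by simp
  moreover have "eventually (\<lambda>t. U t > U s) at_top"
    using U_top by (simp add: filterlim_at_top_dense)
  ultimately show False
    by (metis eventually_at_top_linorder linorder_not_less nle_le)
qed

lemma damp_der: "(damp has_real_derivative exp (-2 * s)) (at s)"
  unfolding damp_def[abs_def] by (rule derivative_eq_intros refl | simp)+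

section \<open>Energy dissipation and relaxation to the zeros of
  \<open>x powr p - c * x\<close>\<close>

definition "energy s = (v1 s)\<^sup>2 / 2 - c * (v s)\<^sup>2 / 2 + v s powr (p + 1) / (p + 1)"

lemma energy_der: "(energy has_real_derivative - damp s * (v1 s)\<^sup>2) (at s)"
proof -
  have D: "((\<lambda>s. v s powr (p + 1)) has_real_derivative (p + 1) * v s powr p * v1 s) (at s)"
    using DERIV_fun_powr[OF v_der v_pos, where r="p+1"] by simp
  have 1: "((\<lambda>s. v s powr (p + 1) / (p + 1)) has_real_derivative v s powr p * v1 s) (at s)"
    using DERIV_cdivide[OF D, of "p+1"] p by (simp add: mult.assoc)
  have 2: "((\<lambda>s. (v1 s)\<^sup>2 / 2) has_real_derivative (- damp s * v1 s + c * v s - v s powr p) * v1 s) (at s)"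
    using DERIV_cdivide[OF DERIV_power[OF v1_der, of 2], of 2] by simp
  have 3: "((\<lambda>s. c * (v s)\<^sup>2 / 2) has_real_derivative c * (v1 s * v s)) (at s)"
    using DERIV_cdivide[OF DERIV_cmult[OF DERIV_power[OF v_der, of 2], of c], of 2] by simp
  have eq: "(- d * x + c * y - z) * x - c * (x * y) + z * x = - d * x\<^sup>2" for d x y z
    by (simp add: algebra_simps power2_eq_square)
  have "((\<lambda>s. (v1 s)\<^sup>2 / 2 - c * (v s)\<^sup>2 / 2 + v s powr (p + 1) / (p + 1))
      has_real_derivative - damp s * (v1 s)\<^sup>2) (at s)"
    by (rule DERIV_cong[OF DERIV_add[OF DERIV_diff[OF 2 3] 1] eq])
  moreover have "energy = (\<lambda>s. (v1 s)\<^sup>2 / 2 - c * (v s)\<^sup>2 / 2 + v s powr (p + 1) / (p + 1))"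
    by (rule ext) (rule energy_def)
  ultimately show ?thesis by simp
qed

text \<open>Solves \<open>exp (-2 * S0) = b\<close>, the point from which at least half of the
  limiting damping acts.\<close>

definition "S0 = - ln b / 2"

lemma damp_bounds: "s \<ge> S0 \<Longrightarrow> b / 2 \<le> damp s" "damp s \<le> b"
proof -
  assume "s \<ge> S0"
  then have "exp (-2 * s) \<le> exp (ln b)" unfolding S0_def by (subst exp_le_cancel_iff) simp
  then show "b / 2 \<le> damp s" using b_pos by (simp add: damp_def)
qed (simp add: damp_def)

lemma energy_mono: "S0 \<le> s \<Longrightarrow> s \<le> t \<Longrightarrow> energy t \<le> energy s"
proof (rule DERIV_nonpos_imp_ge[where a=S0, OF energy_der])
  show "- damp s * (v1 s)\<^sup>2 \<le> 0" if "S0 \<le> s" for s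
    using damp_bounds(1)[OF that] b_pos by (simp add: mult_nonneg_nonneg)
qed

text \<open>For large \<open>v\<close> the term \<open>v powr (p + 1) / (p + 1)\<close> exceeds
  \<open>c * v\<^sup>2 / 2\<close> by at least \<open>v\<^sup>2\<close>, so the nonincreasing energy
  controls \<open>v\<^sup>2\<close>.\<close>

lemma v_bounded: "\<exists>V>0. \<forall>s\<ge>S0. v s \<le> V"
proof -
  \<comment> \<open>Beyond the first entry \<open>v powr (p - 1) / (p + 1)\<close> is at least
    \<open>c / 2 + 1\<close>; beyond the second \<open>v\<^sup>2\<close> exceeds the initial
    energy.\<close>
  define V where "V = max (((p + 1) * (c / 2 + 1)) powr (1 / (p - 1))) (sqrt (\<bar>energy S0\<bar>))"
  have V: "V > 0" using p c_nonneg by (simp add: V_def less_max_iff_disj)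
  have "v s \<le> V" if "s \<ge> S0" for s
  proof (rule ccontr)
    assume "\<not> v s \<le> V"
    then have *: "v s > ((p + 1) * (c / 2 + 1)) powr (1 / (p - 1))" "v s > sqrt (\<bar>energy S0\<bar>)"
      by (auto simp: V_def)
    have "(p + 1) * (c / 2 + 1) \<le> v s powr (p - 1)"
      using powr_mono2[OF _ _ less_imp_le[OF *(1)], of "p - 1"] p c_nonneg by (simp add: powr_powr)
    then have "(c / 2 + 1) * (v s)\<^sup>2 \<le> v s powr (p - 1) / (p + 1) * (v s)\<^sup>2"
      using p by (intro mult_right_mono) (auto simp: field_simps)
    also have "\<dots> = v s powr (p + 1) / (p + 1)"
      using v_pos[of s] powr_add[of "v s" "p - 1" 2] by (simp add: add.commute)
    finally have "c * (v s)\<^sup>2 / 2 + (v s)\<^sup>2 \<le> v s powr (p + 1) / (p + 1)"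
      by (simp add: distrib_right)
    moreover have "(v1 s)\<^sup>2 / 2 \<ge> 0" by simp
    ultimately have "(v s)\<^sup>2 \<le> energy s" unfolding energy_def by linarith
    also have "\<dots> \<le> \<bar>energy S0\<bar>" using energy_mono[of S0 s] that by simp
    finally have "v s \<le> sqrt \<bar>energy S0\<bar>" by (rule real_le_rsqrt)
    with * show False by simp
  qed
  with V show ?thesis by blast
qed

lemma v1_bounded: "\<exists>W>0. \<forall>s\<ge>S0. \<bar>v1 s\<bar> \<le> W"
proof -
  obtain V where V: "V > 0" "\<And>s. s \<ge> S0 \<Longrightarrow> v s \<le> V" using v_bounded by blast
  define W where "W = sqrt (2 * \<bar>energy S0\<bar> + c * V\<^sup>2 + 1)"
  have W: "W > 0" using c_nonneg by (simp add: W_def add_nonneg_pos)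
  have "\<bar>v1 s\<bar> \<le> W" if "s \<ge> S0" for s
  proof -
    have "c * (v s)\<^sup>2 \<le> c * V\<^sup>2"
      using V(2)[OF that] v_pos[of s] c_nonneg by (intro mult_left_mono power_mono) auto
    moreover have "v s powr (p + 1) / (p + 1) \<ge> 0" using p by simp
    ultimately have "(v1 s)\<^sup>2 \<le> 2 * \<bar>energy S0\<bar> + c * V\<^sup>2 + 1"
      using energy_mono[of S0 s] that unfolding energy_def[of s] by simp
    then have "\<bar>v1 s\<bar>\<^sup>2 \<le> 2 * \<bar>energy S0\<bar> + c * V\<^sup>2 + 1" by simp
    then show ?thesis unfolding W_def by (rule real_le_rsqrt)
  qed
  with W show ?thesis by blast
qed

lemma v_powr_bounded:
  assumes "v s \<le> V" "q \<ge> 0" shows "v s powr q \<le> V powr q"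
  using assms v_pos[of s] by (intro powr_mono2) auto

definition "v2 s = - damp s * v1 s + c * v s - v s powr p"

lemma v2_bounded: "\<exists>B>0. \<forall>s\<ge>S0. \<bar>v2 s\<bar> \<le> B"
proof -
  obtain V where V: "V > 0" "\<And>s. s \<ge> S0 \<Longrightarrow> v s \<le> V" using v_bounded by blast
  obtain W where W: "W > 0" "\<And>s. s \<ge> S0 \<Longrightarrow> \<bar>v1 s\<bar> \<le> W" using v1_bounded by blast
  have "\<bar>v2 s\<bar> \<le> b * W + c * V + V powr p + 1" if s: "s \<ge> S0" for s
  proof -
    have "\<bar>damp s\<bar> * \<bar>v1 s\<bar> \<le> b * W"
      using damp_bounds(1)[OF s] damp_bounds(2)[of s] W(2)[OF s] b_pos by (intro mult_mono) auto
    moreover have "c * v s \<le> c * V" using V(2)[OF s] c_nonneg by (intro mult_left_mono)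
    moreover have "c * v s \<ge> 0" using c_nonneg v_pos[of s] by simp
    moreover have "v s powr p \<le> V powr p" using v_powr_bounded[OF V(2)[OF s]] p by simp
    moreover have "v s powr p \<ge> 0" by simp
    ultimately show ?thesis
      unfolding v2_def abs_mult[symmetric] minus_mult_left[symmetric] by arith
  qed
  moreover have "b * W + c * V + V powr p + 1 > 0"
    using b_pos W(1) c_nonneg V(1) by (simp add: add_nonneg_pos)
  ultimately show ?thesis by blast
qed

text \<open>The energy is monotone and, since \<open>v\<close> is bounded, bounded below, hence
  convergent. Its derivative \<open>- damp * v1\<^sup>2\<close> then tends to 0 by
  \<open>barbalat\<close>, and \<open>damp\<close> stays above \<open>b / 2\<close>.\<close>

lemma v1_tendsto: "(v1 \<longlongrightarrow> 0) at_top"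
proof -
  obtain V where V: "V > 0" "\<And>s. s \<ge> S0 \<Longrightarrow> v s \<le> V" using v_bounded by blast
  obtain W where W: "W > 0" "\<And>s. s \<ge> S0 \<Longrightarrow> \<bar>v1 s\<bar> \<le> W" using v1_bounded by blast
  obtain B where B: "B > 0" "\<And>s. s \<ge> S0 \<Longrightarrow> \<bar>v2 s\<bar> \<le> B" using v2_bounded by blast
  have "\<exists>l. (energy \<longlongrightarrow> l) at_top"
  proof (rule antimono_bdd_below_convergent_at_top[where a=S0])
    show "- (c * V\<^sup>2 / 2) \<le> energy s" if s: "S0 \<le> s" for s
    proof -
      have "c * (v s)\<^sup>2 \<le> c * V\<^sup>2"
        using V(2)[OF s] v_pos[of s] c_nonneg by (intro mult_left_mono power_mono) auto
      moreover have "v s powr (p + 1) / (p + 1) \<ge> 0" using p by simp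
      ultimately show ?thesis unfolding energy_def using zero_le_power2[of "v1 s"] by linarith
    qed
  qed (rule energy_mono)
  then obtain l where l: "(energy \<longlongrightarrow> l) at_top" by blast
  have lim: "((\<lambda>s. - damp s * (v1 s)\<^sup>2) \<longlongrightarrow> 0) at_top"
  proof (rule barbalat[where a=S0, OF energy_der _ _ l])
    show "((\<lambda>s. - damp s * (v1 s)\<^sup>2) has_real_derivative
        - exp (-2 * s) * (v1 s)\<^sup>2 - damp s * (2 * v1 s * v2 s)) (at s)" for s
      by (rule DERIV_cong[OF DERIV_mult[OF DERIV_minus[OF damp_der] DERIV_power[OF v1_der]]])
         (simp add: v2_def algebra_simps power2_eq_square)
    show "\<bar>- exp (-2 * s) * (v1 s)\<^sup>2 - damp s * (2 * v1 s * v2 s)\<bar> \<le> b * W\<^sup>2 + b * (2 * W * B)" if s: "S0 \<le> s" for s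
    proof -
      have "exp (-2 * s) \<le> b" using damp_bounds(1)[OF s] by (simp add: damp_def)
      moreover have "(v1 s)\<^sup>2 \<le> W\<^sup>2" using W(2)[OF s] by (metis abs_ge_zero power2_abs power_mono)
      ultimately have "\<bar>- exp (-2 * s) * (v1 s)\<^sup>2\<bar> \<le> b * W\<^sup>2"
        using b_pos by (simp add: abs_mult mult_mono)
      moreover have "\<bar>damp s * (2 * v1 s * v2 s)\<bar> \<le> b * (2 * W * B)"
        unfolding abs_mult using damp_bounds(1)[OF s] damp_bounds(2)[of s] b_pos W(1) W(2)[OF s] B(1) B(2)[OF s]
        by (intro mult_mono) (auto simp: abs_mult)
      ultimately show ?thesis by linarith
    qed
  qed
  have "((\<lambda>s. (v1 s)\<^sup>2) \<longlongrightarrow> 0) at_top"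
  proof (rule tendsto_sandwich[OF _ _ tendsto_const])
    show "((\<lambda>s. - (2 / b) * (- damp s * (v1 s)\<^sup>2)) \<longlongrightarrow> 0) at_top"
      using tendsto_mult_left[OF lim, of "- (2/b)"] by simp
    have "(v1 s)\<^sup>2 \<le> - (2 / b) * (- damp s * (v1 s)\<^sup>2)" if "S0 \<le> s" for s
      using mult_right_mono[OF damp_bounds(1)[OF that], of "(v1 s)\<^sup>2"] b_pos by (simp add: field_simps)
    then show "eventually (\<lambda>s. (v1 s)\<^sup>2 \<le> - (2 / b) * (- damp s * (v1 s)\<^sup>2)) at_top"
      unfolding eventually_at_top_linorder by blast
  qed auto
  then show ?thesis using tendsto_real_sqrt[of "\<lambda>s. (v1 s)\<^sup>2" 0] tendsto_rabs_zero_iff[of v1] by simp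
qed

text \<open>A second use of \<open>barbalat\<close>, now on \<open>v1\<close>, gives
  \<open>v2\<close> tending to 0; what survives in the equation is the force term.\<close>

lemma balance_tendsto: "((\<lambda>s. v s powr p - c * v s) \<longlongrightarrow> 0) at_top"
proof -
  obtain V where V: "V > 0" "\<And>s. s \<ge> S0 \<Longrightarrow> v s \<le> V" using v_bounded by blast
  obtain W where W: "W > 0" "\<And>s. s \<ge> S0 \<Longrightarrow> \<bar>v1 s\<bar> \<le> W" using v1_bounded by blast
  obtain B where B: "B > 0" "\<And>s. s \<ge> S0 \<Longrightarrow> \<bar>v2 s\<bar> \<le> B" using v2_bounded by blast
  have v1': "(v1 has_real_derivative v2 s) (at s)" for s using v1_der by (simp add: v2_def)
  have "(v2 \<longlongrightarrow> 0) at_top"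
  proof (rule barbalat[where a=S0, OF v1' _ _ v1_tendsto])
    have D: "((\<lambda>s. v s powr p) has_real_derivative p * v s powr (p - 1) * v1 s) (at s)" for s
      using DERIV_fun_powr[OF v_der v_pos, where r=p] by simp
    show "(v2 has_real_derivative - exp (-2 * s) * v1 s - damp s * v2 s + c * v1 s - p * v s powr (p - 1) * v1 s) (at s)" for s
      unfolding v2_def[abs_def]
      by (rule DERIV_cong[OF DERIV_diff[OF DERIV_add[OF DERIV_mult[OF DERIV_minus[OF damp_der] v1']
            DERIV_cmult[OF v_der]] D]]) (simp add: v2_def algebra_simps)
    show "\<bar>- exp (-2 * s) * v1 s - damp s * v2 s + c * v1 s - p * v s powr (p - 1) * v1 s\<bar>
        \<le> b * W + b * B + c * W + p * V powr (p - 1) * W" if s: "S0 \<le> s" for s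
    proof -
      have "exp (-2 * s) \<le> b" using damp_bounds(1)[OF s] by (simp add: damp_def)
      then have "\<bar>exp (-2 * s) * v1 s\<bar> \<le> b * W"
        unfolding abs_mult using b_pos W(1) W(2)[OF s] by (intro mult_mono) auto
      moreover have "\<bar>damp s * v2 s\<bar> \<le> b * B"
        unfolding abs_mult using damp_bounds(1)[OF s] damp_bounds(2)[of s] b_pos B(1) B(2)[OF s]
        by (intro mult_mono) auto
      moreover have "\<bar>c * v1 s\<bar> \<le> c * W"
        unfolding abs_mult using c_nonneg W(1) W(2)[OF s] by (intro mult_mono) auto
      moreover have "\<bar>p * v s powr (p - 1) * v1 s\<bar> \<le> p * V powr (p - 1) * W"
        unfolding abs_mult using p W(1) W(2)[OF s] v_powr_bounded[OF V(2)[OF s], of "p - 1"]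
        by (intro mult_mono) auto
      ultimately show ?thesis by linarith
    qed
  qed
  moreover have "((\<lambda>s. - damp s * v1 s) \<longlongrightarrow> - (b - 0 / 2) * 0) at_top"
    unfolding damp_def by (intro tendsto_intros exp_m2 v1_tendsto) auto
  ultimately have "((\<lambda>s. - damp s * v1 s - v2 s) \<longlongrightarrow> 0) at_top"
    using tendsto_diff by fastforce
  then show ?thesis by (simp add: v2_def algebra_simps)
qed

lemma v_cont: "continuous_on S v"
  by (rule DERIV_continuous_on, rule has_field_derivative_at_within, rule v_der)

text \<open>The force vanishes only at 0 and at \<open>L\<close>. It is nonzero at
  \<open>L / 2\<close>, so \<open>v\<close> eventually avoids that value, and by connectedness it
  stays on one side, near a single zero.\<close>

lemma v_tendsto_cases:
  assumes "c > 0"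
  shows "(v \<longlongrightarrow> 0) at_top \<or> (v \<longlongrightarrow> c powr (1 / (p - 1))) at_top"
proof -
  define L where "L = c powr (1 / (p - 1))"
  have L: "L > 0" using assms by (simp add: L_def)
  have Lp: "L powr (p - 1) = c" using assms p by (simp add: L_def powr_powr)
  define g where "g x = x powr p - c * x" for x
  have g: "g x = x * (x powr (p - 1) - c)" if "x \<ge> 0" for x
    using powr_p[OF that] by (simp add: g_def algebra_simps)
  \<comment> \<open>A lower bound for \<open>- g x / x\<close> on \<open>0 < x \<le> L / 2\<close>,
    where the force is governed by its linear part.\<close>
  define k where "k = c - (L/2) powr (p - 1)"
  have k: "k > 0"
    using powr_less_mono2[of "p - 1" "L/2" L] p L Lp by (simp add: k_def)
  have g_lim: "((\<lambda>s. g (v s)) \<longlongrightarrow> 0) at_top" using balance_tendsto by (simp add: g_def)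
  have "g (L/2) \<noteq> 0" unfolding g[OF less_imp_le[OF half_gt_zero[OF L]]] using L k by (simp add: k_def)
  then have "\<bar>g (L/2)\<bar> > 0" by simp
  from tendstoD[OF g_lim this] obtain m where m: "\<And>s. s \<ge> m \<Longrightarrow> v s \<noteq> L/2"
    unfolding eventually_at_top_linorder by force
  have side: "(\<forall>s\<ge>m. v s < L/2) \<or> (\<forall>s\<ge>m. v s > L/2)"
  proof (rule ccontr)
    assume "\<not> ?thesis"
    then obtain x y where xy: "x \<ge> m" "y \<ge> m" "v x \<ge> L/2" "v y \<le> L/2"
      by (auto simp: not_less)
    have "connected (v ` {m..})" by (intro connected_continuous_image v_cont) simp
    then have "L/2 \<in> v ` {m..}"
      using xy connectedD_interval[of "v ` {m..}" "v y" "v x" "L/2"] by auto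
    then obtain z where "z \<ge> m" "v z = L/2" by auto
    then show False using m[of z] by simp
  qed
  then show ?thesis
  proof
    assume low: "\<forall>s\<ge>m. v s < L/2"
    have "(v \<longlongrightarrow> 0) at_top"
    proof (rule tendsto_sandwich[OF _ _ tendsto_const])
      show "((\<lambda>s. - (1 / k) * g (v s)) \<longlongrightarrow> 0) at_top"
        using tendsto_mult_left[OF g_lim, of "- (1/k)"] by simp
      have "v s \<le> - (1 / k) * g (v s)" if "s \<ge> m" for s
      proof -
        have "v s powr (p - 1) \<le> (L/2) powr (p - 1)"
          using low that v_pos[of s] p by (intro powr_mono2) (auto intro: less_imp_le)
        then have "v s * k \<le> v s * (c - v s powr (p - 1))"
          using v_pos[of s] by (intro mult_left_mono) (auto simp: k_def)
        then show ?thesis using g[of "v s"] v_pos[of s] k by (simp add: field_simps)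
      qed
      then show "eventually (\<lambda>s. v s \<le> - (1 / k) * g (v s)) at_top"
        unfolding eventually_at_top_linorder by blast
    qed (use v_pos in \<open>auto intro: less_imp_le always_eventually\<close>)
    then show ?thesis ..
  next
    assume high: "\<forall>s\<ge>m. v s > L/2"
    have "((\<lambda>s. v s powr (p - 1) - c) \<longlongrightarrow> 0) at_top"
    proof (rule Lim_null_comparison)
      show "((\<lambda>s. (2 / L) * \<bar>g (v s)\<bar>) \<longlongrightarrow> 0) at_top"
        using tendsto_mult_left[OF tendsto_rabs[OF g_lim], of "2/L"] by simp
      have "norm (v s powr (p - 1) - c) \<le> (2 / L) * \<bar>g (v s)\<bar>" if "s \<ge> m" for s
      proof -
        have "L / 2 * \<bar>v s powr (p - 1) - c\<bar> \<le> v s * \<bar>v s powr (p - 1) - c\<bar>"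
          using high that by (intro mult_right_mono) (auto intro: less_imp_le)
        also have "\<dots> = \<bar>g (v s)\<bar>" using g[of "v s"] v_pos[of s] by (simp add: abs_mult)
        finally show ?thesis using L by (simp add: field_simps)
      qed
      then show "eventually (\<lambda>s. norm (v s powr (p - 1) - c) \<le> (2 / L) * \<bar>g (v s)\<bar>) at_top"
        unfolding eventually_at_top_linorder by blast
    qed
    then have "((\<lambda>s. v s powr (p - 1)) \<longlongrightarrow> c) at_top" by (simp add: LIM_zero_iff)
    then have "((\<lambda>s. (v s powr (p - 1)) powr (1 / (p - 1))) \<longlongrightarrow> L) at_top"
      unfolding L_def using assms by (intro tendsto_powr tendsto_const) auto
    moreover have "(v s powr (p - 1)) powr (1 / (p - 1)) = v s" for s
      using p v_pos[of s] by (simp add: powr_powr)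
    ultimately show ?thesis by (simp add: L_def)
  qed
qed

lemma v_tendsto_0:
  assumes "c = 0" shows "(v \<longlongrightarrow> 0) at_top"
proof -
  have "((\<lambda>s. v s powr p) \<longlongrightarrow> 0) at_top" using balance_tendsto assms by simp
  then have "((\<lambda>s. (v s powr p) powr (1 / p)) \<longlongrightarrow> 0 powr (1 / p)) at_top"
    using p by (intro tendsto_powr2 tendsto_const) auto
  moreover have "(v s powr p) powr (1 / p) = v s" for s
    using p v_pos[of s] by (simp add: powr_powr)
  ultimately show ?thesis by simp
qed

section \<open>Excluding decay of \<open>v\<close> for \<open>c > 0\<close> and measuring it for
  \<open>c = 0\<close>\<close>

lemma eps_tendsto:
  assumes "(v \<longlongrightarrow> 0) at_top" shows "(\<epsilon> \<longlongrightarrow> 0) at_top"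
proof -
  have "((\<lambda>s. v s powr (p - 1)) \<longlongrightarrow> 0 powr (p - 1)) at_top"
    using assms p v_pos by (intro tendsto_powr2 tendsto_const) (auto intro: less_imp_le always_eventually)
  then have "((\<lambda>s. exp (-2 * s) * a / 2 + v s powr (p - 1)) \<longlongrightarrow> 0 * a / 2 + 0) at_top"
    using p by (intro tendsto_intros exp_m2) auto
  then show ?thesis by (simp add: \<epsilon>_def[abs_def])
qed

text \<open>A regular solution has \<open>Q / U \<longrightarrow> 0\<close>; this fails for a singular one, because \<open>Q \<le> \<eta> U\<close> first
  improves to \<open>Q \<le> exp (- s / 2) U\<close> and then bounds \<open>U\<close>.\<close>

lemma not_regular:
  assumes v0: "(v \<longlongrightarrow> 0) at_top"
  shows "\<exists>\<eta>>0. eventually (\<lambda>s. Q s > \<eta> * U s) at_top"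
proof (rule ccontr)
  assume contra: "\<not> ?thesis"
  \<comment> \<open>The bound 1/4 lets the growth rate \<open>n \<ge> 1\<close> of \<open>Q\<close>
    dominate in the barriers. The bound on \<open>\<eta> * (p - 1)\<close> makes
    \<open>U powr (p - 1)\<close> grow at most like \<open>exp (s / 2)\<close>.\<close>
  define \<eta> where "\<eta> = min (1/4) (1 / (2 * (p - 1)))"
  have \<eta>: "\<eta> > 0" "\<eta> \<le> 1/4" "\<eta> * (p - 1) \<le> 1/2"
  proof -
    show "\<eta> > 0" "\<eta> \<le> 1/4" using p by (auto simp: \<eta>_def)
    have "\<eta> * (p - 1) \<le> 1 / (2 * (p - 1)) * (p - 1)"
      using p by (intro mult_right_mono) (auto simp: \<eta>_def)
    also have "\<dots> = 1/2" using p by (simp add: field_simps)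
    finally show "\<eta> * (p - 1) \<le> 1/2" .
  qed
  have "\<eta> / 4 > 0" using \<eta> by simp
  from order_tendstoD(2)[OF eps_tendsto[OF v0] this]
  obtain m where m: "\<And>s. s \<ge> m \<Longrightarrow> \<epsilon> s < \<eta> / 4"
    unfolding eventually_at_top_linorder by blast
  \<comment> \<open>If \<open>Q\<close> exceeds \<open>\<eta> * U\<close> once, it does so forever,
    since \<open>Q\<close> grows at rate at least 1 up to the small \<open>\<epsilon>\<close>; that
    is the alternative being denied.\<close>
  have QU: "Q s \<le> \<eta> * U s" if "s \<ge> m" for s
  proof (rule ccontr)
    assume "\<not> Q s \<le> \<eta> * U s"
    then have start: "Q s - \<eta> * U s > 0" by simp
    have "Q t - \<eta> * U t > 0" if "t \<ge> s" for t
    proof (rule stays_positive[where a=s and f="\<lambda>t. Q t - \<eta> * U t"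
          and f'="\<lambda>t. (n + exp (-2 * t) / 2) * Q t - \<epsilon> t * U t - \<eta> * Q t", OF _ _ start that])
      show "((\<lambda>t. Q t - \<eta> * U t) has_real_derivative
          (n + exp (-2 * t) / 2) * Q t - \<epsilon> t * U t - \<eta> * Q t) (at t)" for t
        by (intro DERIV_diff Q_der' DERIV_cmult U_der)
      fix t assume t: "s \<le> t" "Q t - \<eta> * U t > 0"
      have "\<epsilon> t * U t \<le> \<eta> / 4 * U t" using m[of t] t \<open>s \<ge> m\<close> U_pos[of t] by (intro mult_right_mono) auto
      moreover have "\<eta> * Q t \<le> 1/4 * Q t" using \<eta> Q_pos[of t] by (intro mult_right_mono) auto
      moreover have "1 * Q t \<le> (n + exp (-2 * t) / 2) * Q t"
        using n Q_pos[of t] by (intro mult_right_mono) (auto intro: add_increasing2)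
      ultimately show "(n + exp (-2 * t) / 2) * Q t - \<epsilon> t * U t - \<eta> * Q t \<ge> 0"
        using t Q_pos[of t] by linarith
    qed
    then have "eventually (\<lambda>t. Q t > \<eta> * U t) at_top"
      unfolding eventually_at_top_linorder by auto
    with contra \<eta>(1) show False by blast
  qed
  define C where "C = U m * exp (- \<eta> * m)"
  have C: "C > 0" using U_pos by (simp add: C_def)
  have UC: "U s \<le> C * exp (\<eta> * s)" if "s \<ge> m" for s
  proof -
    have "U s * exp (- \<eta> * s) \<le> U m * exp (- \<eta> * m)"
    proof (rule DERIV_nonpos_imp_ge[where a=m and f="\<lambda>s. U s * exp (- \<eta> * s)"
          and f'="\<lambda>s. (Q s - \<eta> * U s) * exp (- \<eta> * s)"])
      show "((\<lambda>s. U s * exp (- \<eta> * s)) has_real_derivative (Q s - \<eta> * U s) * exp (- \<eta> * s)) (at s)" for s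
        by (rule derivative_eq_intros U_der refl | simp)+ (simp add: algebra_simps)
      show "(Q s - \<eta> * U s) * exp (- \<eta> * s) \<le> 0" if "m \<le> s" for s
        using QU[OF that] by (simp add: mult_nonpos_nonneg)
    qed (use that in auto)
    then show ?thesis by (simp add: C_def exp_minus field_simps)
  qed
  define K where "K = a / 2 + C powr (p - 1)"
  have K: "K > 0" using a_pos by (simp add: K_def add_pos_nonneg)
  \<comment> \<open>Of the decay \<open>exp (-2 * s)\<close>, a part \<open>exp (s / 2)\<close> is
    spent on the possible growth of \<open>U\<close>. The remaining rate 3/2 is faster than the
    slope \<open>exp (- s / 2)\<close> used next.\<close>
  have epsK: "\<epsilon> s \<le> K * exp (- (3/2) * s)" if s: "s \<ge> m" "s \<ge> 0" for s
  proof -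
    have "U s powr (p - 1) \<le> (C * exp (\<eta> * s)) powr (p - 1)"
      using UC[OF s(1)] U_pos[of s] p by (intro powr_mono2) auto
    also have "\<dots> = C powr (p - 1) * exp (\<eta> * s * (p - 1))"
      using C by (simp add: powr_mult exp_powr_real)
    also have "\<dots> \<le> C powr (p - 1) * exp (1/2 * s)"
      using mult_right_mono[OF \<eta>(3) s(2)] by (intro mult_left_mono) (auto simp: algebra_simps)
    finally have "v s powr (p - 1) \<le> exp (-2 * s) * (C powr (p - 1) * exp (1/2 * s))"
      unfolding v_powr by (intro mult_left_mono) auto
    also have "\<dots> = C powr (p - 1) * exp (- (3/2) * s)" by (simp add: mult_exp_exp)
    finally have "v s powr (p - 1) \<le> C powr (p - 1) * exp (- (3/2) * s)" .
    moreover have "exp (-2 * s) * a / 2 \<le> a / 2 * exp (- (3/2) * s)"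
      using s a_pos by simp
    ultimately show ?thesis by (simp add: \<epsilon>_def K_def algebra_simps)
  qed
  have lim1: "((\<lambda>s. K * exp (- s)) \<longlongrightarrow> K * 0) at_top"
    by (intro tendsto_intros filterlim_compose[OF exp_at_bot] filterlim_uminus_at_bot_at_top)
  have "LIM s at_top. (-1/2::real) * s :> at_bot"
    by (rule filterlim_tendsto_neg_mult_at_bot[OF tendsto_const _ filterlim_ident]) simp
  from filterlim_compose[OF exp_at_bot this]
  have lim2: "((\<lambda>s::real. exp (- s / 2)) \<longlongrightarrow> 0) at_top" by simp
  obtain m2 where m2: "\<And>s. s \<ge> m2 \<Longrightarrow> K * exp (- s) < 1/4 \<and> exp (- s / 2) < 1/4"
    using eventually_conj[OF order_tendstoD(2)[OF lim1, of "1/4"] order_tendstoD(2)[OF lim2, of "1/4"]]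
    unfolding eventually_at_top_linorder by auto
  define m3 where "m3 = Max {m, m2, 0}"
  have m3: "m3 \<ge> m" "m3 \<ge> m2" "m3 \<ge> 0" by (auto simp: m3_def)
  have eps2: "\<epsilon> s \<le> 1/4 * exp (- s / 2)" if "s \<ge> m3" for s
  proof -
    have "\<epsilon> s \<le> (K * exp (- s)) * exp (- s / 2)"
      using epsK[of s] that m3 by (simp add: mult_exp_exp mult.assoc)
    also have "\<dots> \<le> 1/4 * exp (- s / 2)"
      using m2[of s] that m3 by (intro mult_right_mono) auto
    finally show ?thesis .
  qed
  \<comment> \<open>The same barrier with a decaying slope. Crossing it is refuted by growth rates:
    above the barrier \<open>Q\<close> grows at least like \<open>exp (t / 2)\<close>, while
    \<open>QU\<close> and \<open>UC\<close> allow only \<open>exp (t / 4)\<close>.\<close>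
  have QU2: "Q s \<le> exp (- s / 2) * U s" if s: "s \<ge> m3" for s
  proof (rule ccontr)
    assume "\<not> Q s \<le> exp (- s / 2) * U s"
    then have start: "Q s - exp (- s / 2) * U s > 0" by simp
    have pos: "Q t - exp (- t / 2) * U t > 0" if "t \<ge> s" for t
    proof (rule stays_positive[where a=s and f="\<lambda>t. Q t - exp (- t / 2) * U t"
          and f'="\<lambda>t. (n + exp (-2 * t) / 2) * Q t - \<epsilon> t * U t - (exp (- t / 2) * Q t - exp (- t / 2) / 2 * U t)",
          OF _ _ start that])
      show "((\<lambda>t. Q t - exp (- t / 2) * U t) has_real_derivative
          (n + exp (-2 * t) / 2) * Q t - \<epsilon> t * U t - (exp (- t / 2) * Q t - exp (- t / 2) / 2 * U t)) (at t)" for t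
        by (intro DERIV_diff Q_der') (rule derivative_eq_intros U_der refl | simp)+
      fix t assume t: "s \<le> t" "Q t - exp (- t / 2) * U t > 0"
      have "\<epsilon> t * U t \<le> 1/4 * exp (- t / 2) * U t"
        using eps2[of t] t s U_pos[of t] by (intro mult_right_mono) auto
      moreover have "exp (- t / 2) * Q t \<le> 1/4 * Q t"
        using m2[of t] t s m3 Q_pos[of t] by (intro mult_right_mono) auto
      moreover have "1 * Q t \<le> (n + exp (-2 * t) / 2) * Q t"
        using n Q_pos[of t] by (intro mult_right_mono) (auto intro: add_increasing2)
      moreover have "exp (- t / 2) / 2 * U t > 0" using U_pos[of t] by simp
      ultimately show "(n + exp (-2 * t) / 2) * Q t - \<epsilon> t * U t - (exp (- t / 2) * Q t - exp (- t / 2) / 2 * U t) \<ge> 0"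
        using t Q_pos[of t] by linarith
    qed
    have grow: "Q s * exp (- s / 2) \<le> Q t * exp (- t / 2)" if "t \<ge> s" for t
    proof (rule DERIV_nonneg_imp_le[where a=s and f="\<lambda>t. Q t * exp (- t / 2)"
          and f'="\<lambda>t. ((n + exp (-2 * t) / 2) * Q t - \<epsilon> t * U t - Q t / 2) * exp (- t / 2)"])
      show "((\<lambda>t. Q t * exp (- t / 2)) has_real_derivative
          ((n + exp (-2 * t) / 2) * Q t - \<epsilon> t * U t - Q t / 2) * exp (- t / 2)) (at t)" for t
        by (rule derivative_eq_intros Q_der' refl | simp)+ (simp add: algebra_simps)
      fix t assume t: "s \<le> t"
      have "\<epsilon> t * U t \<le> 1/4 * exp (- t / 2) * U t"
        using eps2[of t] t s U_pos[of t] by (intro mult_right_mono) auto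
      moreover have "1 * Q t \<le> (n + exp (-2 * t) / 2) * Q t"
        using n Q_pos[of t] by (intro mult_right_mono) (auto intro: add_increasing2)
      ultimately have "(n + exp (-2 * t) / 2) * Q t - \<epsilon> t * U t - Q t / 2 \<ge> 0"
        using pos[OF t] Q_pos[of t] by linarith
      then show "((n + exp (-2 * t) / 2) * Q t - \<epsilon> t * U t - Q t / 2) * exp (- t / 2) \<ge> 0" by simp
    qed (use that in auto)
    define k where "k = Q s * exp (- s / 2)"
    have k: "k > 0" using Q_pos by (simp add: k_def)
    have bound: "exp (t / 4) \<le> \<eta> * C / k" if t: "t \<ge> s" "t \<ge> 0" for t
    proof -
      have "k * exp (t / 2) \<le> Q t"
        using grow[OF t(1)] by (simp add: k_def exp_minus field_simps)
      also have "\<dots> \<le> \<eta> * U t" using QU[of t] t s m3 by simp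
      also have "\<dots> \<le> \<eta> * (C * exp (\<eta> * t))" using UC[of t] t s m3 \<eta> by (intro mult_left_mono) auto
      also have "\<dots> \<le> \<eta> * (C * exp (t / 4))"
        using mult_right_mono[OF \<eta>(2) t(2)] \<eta> C by (intro mult_left_mono) auto
      finally have "k * (exp (t / 4) * exp (t / 4)) \<le> \<eta> * C * exp (t / 4)"
        by (simp add: mult_exp_exp mult.assoc)
      then have "k * exp (t / 4) \<le> \<eta> * C"
        using mult_le_cancel_right_pos[of "exp (t/4)" "k * exp (t / 4)" "\<eta> * C"] by (simp add: mult.assoc)
      then show ?thesis using k by (simp add: field_simps)
    qed
    define t where "t = Max {s, 0, 4 * (\<eta> * C / k)}"
    have "t \<ge> s" "t \<ge> 0" "t \<ge> 4 * (\<eta> * C / k)" by (auto simp: t_def)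
    with bound[of t] exp_ge_add_one_self[of "t/4"] show False by linarith
  qed
  \<comment> \<open>The slope \<open>exp (- s / 2)\<close> is integrable at infinity, so
    \<open>ln U\<close> has a bounded increase; the exponent is the remaining integral of the
    slope.\<close>
  have "U s \<le> U m3 * exp (2 * exp (- m3 / 2))" if s: "s \<ge> m3" for s
  proof -
    have "U s * 1 \<le> U s * exp (2 * exp (- s / 2))" using U_pos[of s] by (intro mult_left_mono) auto
    also have "\<dots> \<le> U m3 * exp (2 * exp (- m3 / 2))"
    proof (rule DERIV_nonpos_imp_ge[where a=m3 and f="\<lambda>s. U s * exp (2 * exp (- s / 2))"
          and f'="\<lambda>s. (Q s - exp (- s / 2) * U s) * exp (2 * exp (- s / 2))"])
      show "((\<lambda>s. U s * exp (2 * exp (- s / 2))) has_real_derivative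
          (Q s - exp (- s / 2) * U s) * exp (2 * exp (- s / 2))) (at s)" for s
        by (rule derivative_eq_intros U_der refl | simp)+ (simp add: algebra_simps)
      show "(Q s - exp (- s / 2) * U s) * exp (2 * exp (- s / 2)) \<le> 0" if "m3 \<le> s" for s
        using QU2[OF that] by (simp add: mult_nonpos_nonneg)
    qed (use s in auto)
    finally show ?thesis by simp
  qed
  moreover have "eventually (\<lambda>s. U s > U m3 * exp (2 * exp (- m3 / 2))) at_top"
    using U_top by (simp add: filterlim_at_top_dense)
  ultimately show False
    using eventually_conj[OF eventually_ge_at_top[of m3]]
    by (smt (verit) eventually_happens trivial_limit_at_top_linorder)
qed

text \<open>If \<open>v\<close> tended to 0, then so would
  \<open>exp (- (a * s)) * Q s = v1 s + a * v s\<close>. But \<open>not_regular\<close> gives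
  \<open>\<epsilon> * U \<le> (n - a) * Q\<close> eventually, so this positive quantity is
  nondecreasing. The gap \<open>a < n\<close> pays for the comparison.\<close>

lemma v_tendsto_L:
  assumes "a < n"
  shows "(v \<longlongrightarrow> c powr (1 / (p - 1))) at_top"
proof -
  have c: "c > 0" using assms a_pos by (simp add: c_def)
  have "\<not> (v \<longlongrightarrow> 0) at_top"
  proof
    assume v0: "(v \<longlongrightarrow> 0) at_top"
    obtain \<eta> where \<eta>: "\<eta> > 0" "eventually (\<lambda>s. Q s > \<eta> * U s) at_top"
      using not_regular[OF v0] by blast
    have "\<eta> * (n - a) > 0" using \<eta> assms by simp
    from eventually_conj[OF \<eta>(2) order_tendstoD(2)[OF eps_tendsto[OF v0] this]]
    obtain m where m: "\<And>s. s \<ge> m \<Longrightarrow> Q s > \<eta> * U s \<and> \<epsilon> s < \<eta> * (n - a)"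
      unfolding eventually_at_top_linorder by blast
    define k where "k = exp (- (a * m)) * Q m"
    have k: "k > 0" using Q_pos by (simp add: k_def)
    have "k \<le> v1 s + a * v s" if "s \<ge> m" for s
      unfolding k_def Q_v[symmetric]
    proof (rule DERIV_nonneg_imp_le[where a=m and f="\<lambda>s. exp (- (a * s)) * Q s"
          and f'="\<lambda>s. exp (- (a * s)) * ((n + exp (-2 * s) / 2) * Q s - \<epsilon> s * U s - a * Q s)"])
      show "((\<lambda>s. exp (- (a * s)) * Q s) has_real_derivative
          exp (- (a * s)) * ((n + exp (-2 * s) / 2) * Q s - \<epsilon> s * U s - a * Q s)) (at s)" for s
        by (rule derivative_eq_intros Q_der' refl | simp)+ (simp add: algebra_simps)
      fix s assume s: "m \<le> s"
      have "\<epsilon> s * U s \<le> \<eta> * (n - a) * U s"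
        using m[OF s] U_pos[of s] by (intro mult_right_mono) auto
      also have "\<dots> = (n - a) * (\<eta> * U s)" by simp
      also have "\<dots> \<le> (n - a) * Q s"
        using m[OF s] assms by (intro mult_left_mono) auto
      finally have "\<epsilon> s * U s \<le> (n - a) * Q s" .
      moreover have "exp (-2 * s) / 2 * Q s > 0" using Q_pos[of s] by simp
      ultimately have "(n + exp (-2 * s) / 2) * Q s - \<epsilon> s * U s - a * Q s \<ge> 0"
        by (simp add: algebra_simps)
      then show "exp (- (a * s)) * ((n + exp (-2 * s) / 2) * Q s - \<epsilon> s * U s - a * Q s) \<ge> 0" by simp
    qed (use that in auto)
    moreover have "((\<lambda>s. v1 s + a * v s) \<longlongrightarrow> 0 + a * 0) at_top"
      by (intro tendsto_intros v1_tendsto v0)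
    ultimately have "k \<le> 0"
      by (intro tendsto_lowerbound[of "\<lambda>s. v1 s + a * v s" 0 at_top k])
         (auto simp: eventually_at_top_linorder)
    with k show False by simp
  qed
  then show ?thesis using v_tendsto_cases[OF c] by blast
qed

lemma v_asymp_log:
  assumes "a = n"
  shows "((\<lambda>s. s powr (1 / (p - 1)) * v s) \<longlongrightarrow> (b / (p - 1)) powr (1 / (p - 1))) at_top"
proof -
  have c: "c = 0" unfolding c_def using assms by simp
  have ba: "b = a" unfolding b_def using assms by simp
  have v0: "(v \<longlongrightarrow> 0) at_top" by (rule v_tendsto_0[OF c])
  obtain \<eta> where \<eta>: "\<eta> > 0" "eventually (\<lambda>s. Q s > \<eta> * U s) at_top"
    using not_regular[OF v0] by blast
  have v1': "(v1 has_real_derivative - damp s * v1 s - v s powr p) (at s)" for s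
    using v1_der[of s] c by simp
  \<comment> \<open>Minus the logarithmic derivative of \<open>v\<close>. It solves a Riccati
    equation with forcing \<open>v powr (p - 1)\<close>, and showing that it vanishes at infinity
    removes the second-order effects.\<close>
  define \<zeta> where "\<zeta> s = - v1 s / v s" for s
  have damp_lim: "(damp \<longlongrightarrow> b) at_top"
    using tendsto_diff[OF tendsto_const tendsto_divide[OF exp_m2 tendsto_const, of 2], of b]
    by (simp add: damp_def[abs_def])
  have vp0: "((\<lambda>s. v s powr (p - 1)) \<longlongrightarrow> 0) at_top"
    using tendsto_powr2[OF v0 tendsto_const, of "p - 1"] p v_pos
    by (auto intro: less_imp_le always_eventually)
  have \<zeta>_lim: "(\<zeta> \<longlongrightarrow> 0) at_top"
  proof -
    have "eventually (\<lambda>s. exp (-2 * s) < \<eta>) at_top" using order_tendstoD(2)[OF exp_m2 \<eta>(1)] .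
    from eventually_conj[OF \<eta>(2) this] obtain m
      where m: "\<And>s. s \<ge> m \<Longrightarrow> Q s > \<eta> * U s \<and> exp (-2 * s) < \<eta>"
      unfolding eventually_at_top_linorder by blast
    show ?thesis
    proof (rule damped_tendsto_0[where a=m and g="\<lambda>s. v s powr (p - 1)" and \<beta>="\<lambda>s. damp s - \<zeta> s" and k="\<eta>/2"
          and x'="\<lambda>s. v s powr (p - 1) - (damp s - \<zeta> s) * \<zeta> s"])
      show "(\<zeta> has_real_derivative v s powr (p - 1) - (damp s - \<zeta> s) * \<zeta> s) (at s)" for s
      proof -
        have "(\<zeta> has_real_derivative ((- (- damp s * v1 s - v s powr p)) * v s - (- v1 s) * v1 s) / (v s * v s)) (at s)"
          unfolding \<zeta>_def[abs_def] using v_pos[of s]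
          by (intro DERIV_divide DERIV_minus v1' v_der) auto
        moreover have "((- (- damp s * v1 s - v s powr p)) * v s - (- v1 s) * v1 s) / (v s * v s)
            = v s powr (p - 1) - (damp s - \<zeta> s) * \<zeta> s"
          using v_pos[of s] powr_p[of "v s"] by (simp add: \<zeta>_def field_simps)
        ultimately show ?thesis by simp
      qed
      \<comment> \<open>Because \<open>b = a\<close>, the effective rate is \<open>Q / U\<close> up
        to a vanishing term, so \<open>not_regular\<close> is precisely the needed lower
        bound.\<close>
      show "\<eta> / 2 \<le> damp s - \<zeta> s" if "m \<le> s" for s
      proof -
        have "damp s - \<zeta> s = Q s / U s - exp (-2 * s) / 2"
          using U_pos[of s] ba by (simp add: damp_def \<zeta>_def v_def v1_def field_simps)
        moreover have "Q s / U s > \<eta>" using m[OF that] U_pos[of s] by (simp add: field_simps)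
        ultimately show ?thesis using m[OF that] by simp
      qed
    qed (use \<eta> vp0 in auto)
  qed
  \<comment> \<open>The normalisation for which the equation becomes linear:
    \<open>z' = 1 - \<beta> * z\<close> with \<open>\<beta>\<close> tending to \<open>b\<close>,
    hence \<open>z\<close> tends to \<open>1 / b\<close>.\<close>
  define z where "z s = - v1 s * v s powr (- p)" for s
  define \<beta> where "\<beta> s = damp s - p * \<zeta> s" for s
  have \<beta>_lim: "(\<beta> \<longlongrightarrow> b) at_top"
    using tendsto_diff[OF damp_lim tendsto_mult_left[OF \<zeta>_lim, of p]] by (simp add: \<beta>_def[abs_def])
  have z_lim: "(z \<longlongrightarrow> 1 / b) at_top"
  proof -
    from order_tendstoD(1)[OF \<beta>_lim, of "b/2"] b_pos obtain m where m: "\<And>s. s \<ge> m \<Longrightarrow> \<beta> s > b/2"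
      unfolding eventually_at_top_linorder by auto
    have "((\<lambda>s. z s - 1 / b) \<longlongrightarrow> 0) at_top"
    proof (rule damped_tendsto_0[where a=m and g="\<lambda>s. 1 - \<beta> s / b" and \<beta>=\<beta> and k="b/2"
          and x'="\<lambda>s. 1 - \<beta> s * z s"])
      show "((\<lambda>s. z s - 1 / b) has_real_derivative 1 - \<beta> s * z s) (at s)" for s
      proof -
        have D: "((\<lambda>s. v s powr (- p)) has_real_derivative - p * v s powr (- p - 1) * v1 s) (at s)"
          using DERIV_fun_powr[OF v_der v_pos, where r="-p"] by simp
        have "((\<lambda>s. z s - 1 / b) has_real_derivative
            (- (- damp s * v1 s - v s powr p)) * v s powr (- p) + (- p * v s powr (- p - 1) * v1 s) * (- v1 s) - 0) (at s)"
          unfolding z_def by (intro DERIV_diff DERIV_mult DERIV_minus v1' D DERIV_const)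
        moreover have "v s powr (- p - 1) = v s powr (- p) / v s" "v s powr p * v s powr (- p) = 1"
          using v_pos[of s] by (auto simp: powr_diff powr_minus)
        ultimately show ?thesis
          by (rule_tac DERIV_cong) (auto simp: \<beta>_def z_def \<zeta>_def field_simps)
      qed
      show "((\<lambda>s. 1 - \<beta> s / b) \<longlongrightarrow> 0) at_top"
        using tendsto_diff[OF tendsto_const tendsto_divide[OF \<beta>_lim tendsto_const], of b 1] b_pos by simp
      show "b/2 \<le> \<beta> s" if "m \<le> s" for s using m[OF that] by simp
      show "1 - \<beta> s * z s = 1 - \<beta> s / b - \<beta> s * (z s - 1 / b)" for s by (simp add: algebra_simps)
    qed (use b_pos in auto)
    then show ?thesis by (simp add: LIM_zero_iff)
  qed
  \<comment> \<open>Separation of variables in \<open>v' = - z * v powr p\<close>: \<open>W\<close>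
    has derivative \<open>(p - 1) * z\<close>, so it grows linearly and its slope is given by
    l'Hospital's rule.\<close>
  define W where "W s = v s powr (1 - p)" for s
  have W_der: "(W has_real_derivative (p - 1) * z s) (at s)" for s
    using DERIV_fun_powr[OF v_der v_pos, where r="1-p"]
    by (simp add: W_def[abs_def] z_def algebra_simps)
  have "((\<lambda>s. W s / s) \<longlongrightarrow> (p - 1) / b) at_top"
  proof (rule lhospital_at_top_at_top[where f'="\<lambda>s. (p - 1) * z s" and g'="\<lambda>_. 1"])
  qed (use W_der tendsto_mult_left[OF z_lim, of "p - 1"] in \<open>auto simp: filterlim_ident\<close>)
  then have "((\<lambda>s. (W s / s) powr (- 1 / (p - 1))) \<longlongrightarrow> ((p - 1) / b) powr (- 1 / (p - 1))) at_top"
    using p b_pos by (intro tendsto_powr tendsto_const) auto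
  moreover have "((p - 1) / b) powr (- 1 / (p - 1)) = (b / (p - 1)) powr (1 / (p - 1))"
    using p b_pos by (simp add: powr_minus inverse_powr[symmetric])
  moreover have "eventually (\<lambda>s. (W s / s) powr (- 1 / (p - 1)) = s powr (1 / (p - 1)) * v s) at_top"
  proof (rule eventually_mono[OF eventually_gt_at_top[of 0]])
    fix s :: real assume s: "s > 0"
    have "W s powr (- 1 / (p - 1)) = v s powr 1"
      unfolding W_def powr_powr by (rule arg_cong[of _ _ "\<lambda>x. v s powr x"]) (use p in \<open>simp add: field_simps\<close>)
    then show "(W s / s) powr (- 1 / (p - 1)) = s powr (1 / (p - 1)) * v s"
      using s v_pos[of s] by (simp add: powr_divide W_def powr_minus field_simps)
  qed
  ultimately show ?thesis using tendsto_cong by force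
qed

end

subsection \<open>Solutions on a half-line\<close>

lemma DERIV_half_line:
  assumes "(f has_real_derivative D) (at t within {0..})" "t > 0"
  shows "(f has_real_derivative D) (at t)"
proof -
  have "at t within {0..} = at t"
    by (rule at_within_nhd[of _ "{0<..}"]) (use assms(2) in auto)
  then show ?thesis using assms(1) by simp
qed

lemma half_line_cont:
  fixes f f' :: "real \<Rightarrow> real"
  assumes "\<And>t. t \<ge> 0 \<Longrightarrow> (f has_real_derivative f' t) (at t within {0..})" "S \<subseteq> {0..}"
  shows "continuous_on S f"
proof (rule continuous_on_subset[OF _ assms(2)])
  show "continuous_on {0..} f" by (rule DERIV_continuous_on[of _ _ f']) (use assms in auto)
qed

lemma half_line_mono:
  fixes f f' :: "real \<Rightarrow> real"
  assumes "\<And>t. t \<ge> 0 \<Longrightarrow> (f has_real_derivative f' t) (at t within {0..})"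
    and "\<And>t. 0 < t \<Longrightarrow> t < T \<Longrightarrow> f' t \<ge> 0" "T \<ge> 0"
  shows "f 0 \<le> f T"
proof (rule DERIV_nonneg_imp_increasing_open[OF \<open>T \<ge> 0\<close>])
  show "\<exists>y. (f has_real_derivative y) (at x) \<and> 0 \<le> y" if "0 < x" "x < T" for x
    using DERIV_half_line[OF assms(1)] assms(2) that by (meson less_imp_le)
qed (rule half_line_cont[OF assms(1)], auto)

lemma half_line_antimono:
  fixes f f' :: "real \<Rightarrow> real"
  assumes "\<And>t. t \<ge> 0 \<Longrightarrow> (f has_real_derivative f' t) (at t within {0..})"
    and "\<And>t. 0 < t \<Longrightarrow> t < T \<Longrightarrow> f' t \<le> 0" "T \<ge> 0"
  shows "f T \<le> f 0"
  using half_line_mono[of "\<lambda>t. - f t" "\<lambda>t. - f' t" T] assms by (auto intro: DERIV_minus)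

text \<open>Truncation to \<open>[0, M]\<close>. Composed with it, \<open>x powr p\<close> is
  globally Lipschitz and the global initial value lemma applies; every later bound
  \<open>0 \<le> v \<le> M\<close> undoes it.\<close>

definition clamp :: "real \<Rightarrow> real \<Rightarrow> real" where
  "clamp M x = max 0 (min M x)"

lemma clamp_eq: "0 \<le> x \<Longrightarrow> x \<le> M \<Longrightarrow> clamp M x = x"
  and clamp_bounds: "M \<ge> 0 \<Longrightarrow> 0 \<le> clamp M x \<and> clamp M x \<le> M"
  and clamp_lipschitz: "\<bar>clamp M x - clamp M y\<bar> \<le> \<bar>x - y\<bar>"
  by (auto simp: clamp_def)

lemma powr_diff_le:
  fixes x y M p :: real
  assumes "p > 1" "0 \<le> x" "x \<le> y" "y \<le> M"
  shows "y powr p - x powr p \<le> p * M powr (p - 1) * (y - x)"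
proof (cases "x = y")
  case False
  then have "x < y" using assms by simp
  have "continuous_on {x..y} (\<lambda>x. x powr p)"
    using assms by (intro continuous_on_powr' continuous_intros) auto
  moreover have "(\<lambda>x. x powr p) differentiable (at z)" if "x < z" for z
    using has_real_derivative_powr[of z p] that assms unfolding real_differentiable_def by auto
  ultimately obtain l z where z: "x < z" "z < y" "((\<lambda>x. x powr p) has_real_derivative l) (at z)"
      "y powr p - x powr p = (y - x) * l"
    using MVT[OF \<open>x < y\<close>, of "\<lambda>x. x powr p"] by auto
  have "l = p * z powr (p - 1)"
    using DERIV_unique[OF z(3) has_real_derivative_powr] z assms by simp
  also have "\<dots> \<le> p * M powr (p - 1)"
    using z assms by (intro mult_left_mono powr_mono2) auto
  finally show ?thesis using z(4) \<open>x < y\<close> by (simp add: mult.commute[of _ "y - x"])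
qed simp

lemma clamp_powr_lipschitz:
  assumes "p > 1" "M \<ge> 0"
  shows "\<bar>clamp M x powr p - clamp M y powr p\<bar> \<le> p * M powr (p - 1) * \<bar>x - y\<bar>"
proof -
  have "\<bar>clamp M x powr p - clamp M y powr p\<bar> \<le> p * M powr (p - 1) * \<bar>clamp M x - clamp M y\<bar>"
  proof (induction x y rule: linorder_wlog)
    case (le x y)
    have "clamp M x \<le> clamp M y" using le by (auto simp: clamp_def)
    then show ?case
      using powr_diff_le[of p "clamp M x" "clamp M y" M] clamp_bounds[OF assms(2)] assms
        powr_mono2[of p "clamp M x" "clamp M y"] by (simp add: abs_real_def)
  qed (simp add: abs_minus_commute)
  also have "\<dots> \<le> p * M powr (p - 1) * \<bar>x - y\<bar>"
    using assms by (intro mult_left_mono clamp_lipschitz) auto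
  finally show ?thesis .
qed

text \<open>For \<open>c > 0\<close> the energy is nonincreasing in both directions away from the radius where the
  damping vanishes, and its sublevel set through \<open>(v0, 0)\<close> is compact in \<open>{v > 0}\<close>.\<close>

lemma trapped_half_line:
  fixes p c v0 K :: real and d :: "real \<Rightarrow> real"
  assumes p: "p > 1" and c: "c > 0"
    and d: "continuous_on {0..} d" "\<And>t. t \<ge> 0 \<Longrightarrow> 0 \<le> d t" "\<And>t. t \<ge> 0 \<Longrightarrow> d t \<le> K * exp (2 * t)"
    and v0: "0 < v0" "v0 < ((p + 1) * c / 2) powr (1 / (p - 1))"
  obtains v w m where "v 0 = v0" "w 0 = 0" "m > 0" "\<And>t. t \<ge> 0 \<Longrightarrow> v t > m"
    "\<And>t. t \<ge> 0 \<Longrightarrow> (v has_real_derivative w t) (at t within {0..})"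
    "\<And>t. t \<ge> 0 \<Longrightarrow> (w has_real_derivative - d t * w t + (c * v t - v t powr p)) (at t within {0..})"
proof -
  \<comment> \<open>The positive zero of the potential \<open>F\<close>. Starting below it gives
    negative energy, and it serves as the upper wall.\<close>
  define M where "M = ((p + 1) * c / 2) powr (1 / (p - 1))"
  have M: "M > v0" "M powr (p - 1) = (p + 1) * c / 2"
    using v0 p c by (auto simp: M_def powr_powr)
  have pw: "x powr (p + 1) = x\<^sup>2 * x powr (p - 1)" if "x > 0" for x :: real
    using powr_add[of x 2 "p - 1"] that by (simp add: add.commute)
  define F where "F x = x powr (p + 1) / (p + 1) - c * x\<^sup>2 / 2" for x
  have FM: "F M = 0" unfolding F_def pw[OF order.strict_trans[OF v0(1) M(1)]] M(2) using p by (simp add: field_simps)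
  have v0M: "v0 powr (p - 1) < (p + 1) * c / 2"
    unfolding M(2)[symmetric] using v0 M p by (intro powr_less_mono2) auto
  \<comment> \<open>Chosen to make \<open>F v0 = - (c / 2) * k * v0\<^sup>2\<close>.\<close>
  define k where "k = 1 - 2 * v0 powr (p - 1) / ((p + 1) * c)"
  have pc: "(p + 1) * c > 0" using p c by simp
  have k: "0 < k" "k < 1" using v0M pc v0(1) by (auto simp: k_def divide_less_eq)
  have Fv0: "F v0 = - (c / 2) * k * v0\<^sup>2"
  proof -
    have "c / 2 * (2 * A / ((p + 1) * c)) = A / (p + 1)" for A using c by simp
    then have "v0 powr (p - 1) / (p + 1) - c / 2 = - (c / 2) * k"
      by (simp add: k_def right_diff_distrib)
    then have "(v0 powr (p - 1) / (p + 1) - c / 2) * v0\<^sup>2 = - (c / 2) * k * v0\<^sup>2" by simp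
    then show ?thesis unfolding F_def pw[OF v0(1)] by (simp add: algebra_simps)
  qed
  have Fv0neg: "F v0 < 0" using Fv0 k c v0 by (simp add: mult_neg_pos)
  \<comment> \<open>An explicit lower wall:
    \<open>F m \<ge> - (c / 2) * k\<^sup>2 * v0\<^sup>2\<close>, and \<open>k < 1\<close> puts this
    above \<open>F v0\<close>. The turning point of the potential need not be computed.\<close>
  define m where "m = k * v0"
  have m: "0 < m" "m < v0" using k v0 by (auto simp: m_def)
  have Fm: "F v0 < F m"
  proof -
    have "k * k * v0\<^sup>2 < k * v0\<^sup>2" using k v0 by simp
    then have "c / 2 * (k * k * v0\<^sup>2) < c / 2 * (k * v0\<^sup>2)" using c by (intro mult_strict_left_mono) auto
    then have "F v0 < - (c * m\<^sup>2 / 2)" by (simp add: Fv0 m_def power2_eq_square algebra_simps)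
    also have "\<dots> \<le> F m" using p by (simp add: F_def)
    finally show ?thesis .
  qed
  define g where "g x = c * clamp M x - clamp M x powr p" for x
  define K' where "K' = max K (c + p * M powr (p - 1))"
  obtain v w where vw: "v 0 = v0" "w 0 = 0"
    "\<And>t. t \<ge> 0 \<Longrightarrow> (v has_real_derivative w t) (at t within {0..})"
    "\<And>t. t \<ge> 0 \<Longrightarrow> (w has_real_derivative - d t * w t + g (v t)) (at t within {0..})"
  proof (rule damped_ivp_half_line[of d K' g v0 0])
    show "\<bar>d t\<bar> \<le> K' * exp (2 * t)" if "t \<ge> 0" for t
    proof -
      have "\<bar>d t\<bar> \<le> K * exp (2 * t)" using d(2,3)[OF that] by simp
      also have "\<dots> \<le> K' * exp (2 * t)" by (intro mult_right_mono) (auto simp: K'_def)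
      finally show ?thesis .
    qed
    show "\<bar>g x - g y\<bar> \<le> K' * \<bar>x - y\<bar>" for x y
    proof -
      have "\<bar>c * (clamp M x - clamp M y)\<bar> \<le> c * \<bar>x - y\<bar>"
        unfolding abs_mult using c clamp_lipschitz[of M x y] by (intro mult_mono) auto
      moreover have "\<bar>clamp M x powr p - clamp M y powr p\<bar> \<le> p * M powr (p - 1) * \<bar>x - y\<bar>"
        by (rule clamp_powr_lipschitz[OF p]) (use v0 M in simp)
      moreover have "g x - g y = c * (clamp M x - clamp M y) - (clamp M x powr p - clamp M y powr p)"
        by (simp add: g_def algebra_simps)
      ultimately have "\<bar>g x - g y\<bar> \<le> c * \<bar>x - y\<bar> + p * M powr (p - 1) * \<bar>x - y\<bar>" by linarith
      then have "\<bar>g x - g y\<bar> \<le> (c + p * M powr (p - 1)) * \<bar>x - y\<bar>" by (simp add: distrib_right)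
      also have "\<dots> \<le> K' * \<bar>x - y\<bar>" by (intro mult_right_mono) (auto simp: K'_def)
      finally show ?thesis .
    qed
  qed (use d in auto)
  define f where "f t = min (v t - m) (M - v t)" for t
  have fc: "continuous_on S f" if "S \<subseteq> {0..}" for S
    unfolding f_def[abs_def] by (intro continuous_intros half_line_cont[OF vw(3)] that)
  have f0: "f 0 > 0" using m M(1) vw(1) by (simp add: f_def)
  have f_pos: "f T > 0" if T: "T \<ge> 0" for T
  proof (rule ccontr)
    assume "\<not> f T > 0"
    then obtain \<tau> where \<tau>: "0 < \<tau>" "f \<tau> = 0" "\<And>s. 0 \<le> s \<Longrightarrow> s < \<tau> \<Longrightarrow> f s > 0"
      using first_exit[OF fc _ f0, of T] f0 T by (auto simp: not_less)
    \<comment> \<open>Until the first exit from \<open>(m, M)\<close> the truncation is inactive and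
      \<open>E\<close> is nonincreasing, so \<open>F (v \<tau>) \<le> F v0\<close>; both walls have
      a strictly higher potential.\<close>
    define E where "E t = (w t)\<^sup>2 / 2 + F (v t)" for t
    have "E \<tau> \<le> E 0"
    proof (rule DERIV_nonpos_imp_decreasing_open[of 0 \<tau>])
      show "\<exists>y. (E has_real_derivative y) (at t) \<and> y \<le> 0" if t: "0 < t" "t < \<tau>" for t
      proof -
        have vt: "m < v t" "v t < M" using \<tau>(3)[of t] t by (auto simp: f_def)
        then have vt0: "v t > 0" using m by simp
        have gv: "g (v t) = c * v t - v t powr p" using vt m by (simp add: g_def clamp_eq)
        have V: "(v has_real_derivative w t) (at t)" by (rule DERIV_half_line) (use vw t in auto)
        have W: "(w has_real_derivative - d t * w t + g (v t)) (at t)" by (rule DERIV_half_line) (use vw t in auto)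
        have 1: "((\<lambda>t. v t powr (p + 1) / (p + 1)) has_real_derivative v t powr p * w t) (at t)"
          using DERIV_cdivide[OF DERIV_fun_powr[OF V vt0, where r="p+1"], of "p+1"] p by (simp add: mult.assoc)
        have 2: "((\<lambda>t. (w t)\<^sup>2 / 2) has_real_derivative (- d t * w t + g (v t)) * w t) (at t)"
          using DERIV_cdivide[OF DERIV_power[OF W, of 2], of 2] by simp
        have 3: "((\<lambda>t. c * (v t)\<^sup>2 / 2) has_real_derivative c * (w t * v t)) (at t)"
          using DERIV_cdivide[OF DERIV_cmult[OF DERIV_power[OF V, of 2], of c], of 2] by simp
        have "(E has_real_derivative (- d t * w t + g (v t)) * w t + (v t powr p * w t - c * (w t * v t))) (at t)"
          unfolding E_def[abs_def] F_def by (intro DERIV_add DERIV_diff 1 2 3)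
        moreover have "(- d t * w t + g (v t)) * w t + (v t powr p * w t - c * (w t * v t)) = - (d t * (w t)\<^sup>2)"
          unfolding gv by (simp add: algebra_simps power2_eq_square)
        moreover have "d t * (w t)\<^sup>2 \<ge> 0" using d(2)[of t] t by simp
        ultimately show ?thesis by auto
      qed
      have v_pos: "v x > 0" if "x \<in> {0..\<tau>}" for x
      proof -
        have "f x \<ge> 0" using \<tau>(2) \<tau>(3)[of x] that by (cases "x = \<tau>") auto
        then show ?thesis using m by (simp add: f_def)
      qed
      show "continuous_on {0..\<tau>} E"
        unfolding E_def[abs_def] F_def
        using p by (intro continuous_intros half_line_cont[OF vw(3)] half_line_cont[OF vw(4)])
          (auto dest: v_pos)
    qed (use \<tau> in auto)
    moreover have "E 0 = F v0" using vw(1,2) by (simp add: E_def)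
    moreover have "F (v \<tau>) \<le> E \<tau>" by (simp add: E_def)
    ultimately have "F (v \<tau>) \<le> F v0" by linarith
    moreover have "v \<tau> = m \<or> v \<tau> = M" using \<tau>(2) by (auto simp: f_def min_def split: if_splits)
    ultimately show False using Fm FM Fv0neg by auto
  qed
  have bounds: "m < v t" "v t < M" if "t \<ge> 0" for t using f_pos[OF that] by (auto simp: f_def)
  show ?thesis
  proof (rule that[of v w m])
    show "(w has_real_derivative - d t * w t + (c * v t - v t powr p)) (at t within {0..})" if "t \<ge> 0" for t
      using vw(4)[OF that] bounds[OF that] m by (simp add: g_def clamp_eq)
  qed (use vw bounds m in auto)
qed

section \<open>Barriers for the borderline case \<open>c = 0\<close>\<close>

lemma powr_p_le:
  fixes p x y :: real
  assumes "p > 1" "0 \<le> x" "x \<le> y"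
  shows "x powr p \<le> x * y powr (p - 1)"
proof -
  have "x powr p = x * x powr (p - 1)" using assms by (cases "x = 0") (auto simp: powr_mult_base)
  also have "\<dots> \<le> x * y powr (p - 1)" using assms by (intro mult_left_mono powr_mono2) auto
  finally show ?thesis .
qed

lemma integrating_factor_half_line:
  fixes D d w :: "real \<Rightarrow> real"
  assumes "(D has_real_derivative d t) (at t)" "(w has_real_derivative - d t * w t + y) (at t within {0..})"
  shows "((\<lambda>t. exp (D t) * w t) has_real_derivative exp (D t) * y) (at t within {0..})"
proof -
  have "((\<lambda>t. exp (D t)) has_real_derivative exp (D t) * d t) (at t within {0..})"
    by (rule has_field_derivative_at_within) (rule DERIV_fun_exp[OF assms(1)])
  from DERIV_mult[OF this assms(2)] show ?thesis by (simp add: algebra_simps)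
qed

lemma half_line_decay:
  fixes f f' :: "real \<Rightarrow> real"
  assumes "\<And>t. t \<ge> 0 \<Longrightarrow> (f has_real_derivative f' t) (at t within {0..})"
    and "\<And>t. 0 < t \<Longrightarrow> t < T \<Longrightarrow> f' t \<ge> - k * f t" "T \<ge> 0"
  shows "f 0 * exp (- k * T) \<le> f T"
proof -
  have "exp (k * 0) * f 0 \<le> exp (k * T) * f T"
  proof (rule half_line_mono[where f'="\<lambda>t. exp (k * t) * (f' t + k * f t)"])
    fix t :: real assume t: "t \<ge> 0"
    have "(f has_real_derivative - k * f t + (f' t + k * f t)) (at t within {0..})"
      using assms(1)[OF t] by simp
    moreover have "((\<lambda>t. k * t) has_real_derivative k) (at t)" by (auto intro!: derivative_eq_intros)
    ultimately show "((\<lambda>t. exp (k * t) * f t) has_real_derivative exp (k * t) * (f' t + k * f t)) (at t within {0..})"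
      using integrating_factor_half_line[where d="\<lambda>_. k"] by blast
  next
    show "0 \<le> exp (k * t) * (f' t + k * f t)" if "0 < t" "t < T" for t
      using assms(2)[OF that] by simp
  qed (use assms in auto)
  then show ?thesis by (simp add: exp_minus field_simps)
qed

text \<open>For \<open>c = 0\<close> there is no trapping energy level; positivity comes from smallness of \<open>v0\<close>.\<close>

lemma small_forward_half_line:
  fixes p b v0 :: real
  assumes p: "p > 1" and b: "b > 0" and v0: "0 < v0" "v0 powr (p - 1) \<le> 1"
  obtains v w where "v 0 = v0" "w 0 = 0" "\<And>t. t \<ge> 0 \<Longrightarrow> v t > 0"
    "\<And>t. t \<ge> 0 \<Longrightarrow> (v has_real_derivative w t) (at t within {0..})"
    "\<And>t. t \<ge> 0 \<Longrightarrow> (w has_real_derivative - ((b + 3) * exp (2 * t) - b) * w t - v t powr p) (at t within {0..})"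
proof -
  define d where "d t = (b + 3) * exp (2 * t) - b" for t
  define D where "D t = (b + 3) * exp (2 * t) / 2 - b * t" for t
  define g where "g x = - (clamp v0 x powr p)" for x
  \<comment> \<open>The largest size of the truncated force. Smallness of \<open>v0\<close> is used
    only to get \<open>P \<le> v0\<close>.\<close>
  define P where "P = v0 powr p"
  have "v0 powr p \<le> v0 * v0 powr (p - 1)" using powr_p_le[OF p, of v0 v0] v0 by simp
  also have "\<dots> \<le> v0 * 1" using v0 by (intro mult_left_mono) auto
  finally have P: "0 < P" "P \<le> v0" using v0 by (auto simp: P_def)
  have g: "g x \<le> 0" "- P \<le> g x" for x
    using clamp_bounds[of v0 x] v0 p by (auto simp: g_def P_def intro!: powr_mono2)
  have D: "(D has_real_derivative d t) (at t)" for t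
    unfolding D_def[abs_def] d_def by (auto intro!: derivative_eq_intros)
  define K where "K = max (2 * b + 3) (p * v0 powr (p - 1))"
  obtain v w where vw: "v 0 = v0" "w 0 = 0"
    "\<And>t. t \<ge> 0 \<Longrightarrow> (v has_real_derivative w t) (at t within {0..})"
    "\<And>t. t \<ge> 0 \<Longrightarrow> (w has_real_derivative - d t * w t + g (v t)) (at t within {0..})"
  proof (rule damped_ivp_half_line[of d K g v0 0])
    show "continuous_on {0..} d" unfolding d_def by (intro continuous_intros)
    show "\<bar>d t\<bar> \<le> K * exp (2 * t)" if "t \<ge> 0" for t
    proof -
      have "b * 1 \<le> b * exp (2 * t)" using that b by (intro mult_left_mono) auto
      moreover have "exp (2 * t) > 0" by simp
      moreover have "d t = b * exp (2 * t) + 3 * exp (2 * t) - b"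
        "(2 * b + 3) * exp (2 * t) = 2 * (b * exp (2 * t)) + 3 * exp (2 * t)"
        by (auto simp: d_def algebra_simps)
      ultimately have "\<bar>d t\<bar> \<le> (2 * b + 3) * exp (2 * t)" using b by linarith
      also have "\<dots> \<le> K * exp (2 * t)" by (intro mult_right_mono) (auto simp: K_def)
      finally show ?thesis .
    qed
    show "\<bar>g x - g y\<bar> \<le> K * \<bar>x - y\<bar>" for x y
      using clamp_powr_lipschitz[OF p, of v0 x y] v0 mult_right_mono[of "p * v0 powr (p - 1)" K "\<bar>x - y\<bar>"]
      by (simp add: g_def K_def)
  qed auto
  have w_le: "w t \<le> 0" if "t \<ge> 0" for t
  proof -
    have "exp (D t) * w t \<le> exp (D 0) * w 0"
    proof (rule half_line_antimono[where f'="\<lambda>t. exp (D t) * g (v t)"])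
      show "((\<lambda>t. exp (D t) * w t) has_real_derivative exp (D t) * g (v t)) (at t within {0..})" if "t \<ge> 0" for t
        by (rule integrating_factor_half_line[where d=d, OF D vw(4)[OF that]])
    qed (use that g in \<open>auto simp: mult_nonneg_nonpos\<close>)
    then show ?thesis by (simp add: vw(2) mult_le_0_iff)
  qed
  \<comment> \<open>The barrier \<open>- P * exp (-2 * t)\<close> explains the 3 in
    \<open>b + 3\<close>: its own derivative costs 2, and the remaining 1 absorbs the force, as
    \<open>(d t - 2) * exp (-2 * t) \<ge> 1\<close>.\<close>
  have w_ge: "w t + P * exp (-2 * t) \<ge> 0" if "t \<ge> 0" for t
  proof -
    have "exp (D 0) * (w 0 + P * exp (-2 * 0)) \<le> exp (D t) * (w t + P * exp (-2 * t))"
    proof (rule half_line_mono[where f'="\<lambda>t. exp (D t) * (g (v t) + (d t - 2) * (P * exp (-2 * t)))"])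
      fix t :: real assume t: "t \<ge> 0"
      have "((\<lambda>t. P * exp (-2 * t)) has_real_derivative - 2 * (P * exp (-2 * t))) (at t within {0..})"
        by (rule has_field_derivative_at_within) (auto intro!: derivative_eq_intros)
      from DERIV_add[OF vw(4)[OF t] this]
      have "((\<lambda>t. w t + P * exp (-2 * t)) has_real_derivative
          - d t * (w t + P * exp (-2 * t)) + (g (v t) + (d t - 2) * (P * exp (-2 * t)))) (at t within {0..})"
        by (rule DERIV_cong) (simp add: algebra_simps)
      from integrating_factor_half_line[where d=d, OF D this]
      show "((\<lambda>t. exp (D t) * (w t + P * exp (-2 * t))) has_real_derivative
          exp (D t) * (g (v t) + (d t - 2) * (P * exp (-2 * t)))) (at t within {0..})" .
    next
      fix t :: real assume t: "0 < t"
      have "(d t - 2) * exp (-2 * t) = (b + 3) * (exp (2 * t) * exp (-2 * t)) - (b + 2) * exp (-2 * t)"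
        by (simp add: d_def algebra_simps)
      moreover have "exp (2 * t) * exp (-2 * t) = 1" by (simp add: mult_exp_exp)
      moreover have "(b + 2) * exp (-2 * t) \<le> (b + 2) * 1" using t b by (intro mult_left_mono) auto
      ultimately have "1 \<le> (d t - 2) * exp (-2 * t)" by simp
      then have "P * 1 \<le> P * ((d t - 2) * exp (-2 * t))" using P by (intro mult_left_mono) auto
      then have "0 \<le> g (v t) + (d t - 2) * (P * exp (-2 * t))"
        using g(2)[of "v t"] by (simp add: algebra_simps)
      then show "0 \<le> exp (D t) * (g (v t) + (d t - 2) * (P * exp (-2 * t)))" by simp
    qed (use that in auto)
    then have "0 < exp (D t) * (w t + P * exp (-2 * t))"
      using P vw(2) by (smt (verit) exp_gt_zero mult_pos_pos)
    then show ?thesis by (simp add: zero_less_mult_iff)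
  qed
  have v_le: "v t \<le> v0" if "t \<ge> 0" for t
    using half_line_antimono[OF vw(3) w_le that] vw(1) by simp
  have v_pos: "v t > 0" if "t \<ge> 0" for t
  proof -
    \<comment> \<open>Integrating the barrier, \<open>v\<close> loses in total at most
      \<open>P / 2 \<le> v0 / 2\<close>.\<close>
    have "v 0 - P * exp (-2 * 0) / 2 \<le> v t - P * exp (-2 * t) / 2"
    proof (rule half_line_mono[where f'="\<lambda>t. w t + P * exp (-2 * t)"])
      fix t :: real assume t: "t \<ge> 0"
      have "((\<lambda>t. P * exp (-2 * t) / 2) has_real_derivative - (P * exp (-2 * t))) (at t within {0..})"
        by (rule has_field_derivative_at_within) (auto intro!: derivative_eq_intros)
      from DERIV_diff[OF vw(3)[OF t] this]
      show "((\<lambda>t. v t - P * exp (-2 * t) / 2) has_real_derivative w t + P * exp (-2 * t)) (at t within {0..})"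
        by simp
    qed (use w_ge that in auto)
    moreover have "P * exp (-2 * t) > 0" "P * exp (-2 * 0) = P" using P by auto
    ultimately show ?thesis using P v0(1) vw(1) by linarith
  qed
  show ?thesis
  proof (rule that[of v w])
    show "(w has_real_derivative - ((b + 3) * exp (2 * t) - b) * w t - v t powr p) (at t within {0..})"
      if "t \<ge> 0" for t
      using vw(4)[OF that] v_pos[OF that] v_le[OF that] by (simp add: g_def clamp_eq d_def)
  qed (use vw v_pos in auto)
qed

text \<open>The barrier \<open>\<kappa>\<close> satisfies \<open>\<kappa>' + d \<kappa> = b \<kappa>\<close>, so that \<open>w + \<kappa> v > 0\<close> persists
  as long as \<open>v powr (p - 1) \<le> (b / 2) \<kappa>\<close>.\<close>

lemma small_backward_half_line:
  fixes p b v0 :: real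
  assumes p: "p > 1" and b: "b > 0" and v0: "0 < v0" "v0 powr (p - 1) \<le> b\<^sup>2 / 4 * exp (- (b + 3) / 2)"
  obtains v w where "v 0 = v0" "w 0 = 0" "\<And>t. t \<ge> 0 \<Longrightarrow> v t \<ge> v0 * exp (- (b / 2) * t)"
    "\<And>t. t \<ge> 0 \<Longrightarrow> (v has_real_derivative w t) (at t within {0..})"
    "\<And>t. t \<ge> 0 \<Longrightarrow> (w has_real_derivative - (b - (b + 3) * exp (-2 * t)) * w t - v t powr p) (at t within {0..})"
proof -
  define d where "d t = b - (b + 3) * exp (-2 * t)" for t
  define D where "D t = b * t + (b + 3) * exp (-2 * t) / 2" for t
  define g where "g x = - (clamp v0 x powr p)" for x
  have g: "g x \<le> 0" for x by (simp add: g_def)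
  have D: "(D has_real_derivative d t) (at t)" for t
    unfolding D_def[abs_def] d_def by (auto intro!: derivative_eq_intros)
  define K where "K = max (2 * b + 3) (p * v0 powr (p - 1))"
  obtain v w where vw: "v 0 = v0" "w 0 = 0"
    "\<And>t. t \<ge> 0 \<Longrightarrow> (v has_real_derivative w t) (at t within {0..})"
    "\<And>t. t \<ge> 0 \<Longrightarrow> (w has_real_derivative - d t * w t + g (v t)) (at t within {0..})"
  proof (rule damped_ivp_half_line[of d K g v0 0])
    show "continuous_on {0..} d" unfolding d_def by (intro continuous_intros)
    show "\<bar>d t\<bar> \<le> K * exp (2 * t)" if "t \<ge> 0" for t
    proof -
      have "(b + 3) * exp (-2 * t) \<le> (b + 3) * 1" using that b by (intro mult_left_mono) auto
      moreover have "0 < (b + 3) * exp (-2 * t)" using b by simp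
      moreover have "\<bar>b - x\<bar> \<le> 2 * b + 3" if "x \<le> (b + 3) * 1" "0 < x" for x
        using that b by (simp add: abs_le_iff)
      ultimately have "\<bar>d t\<bar> \<le> 2 * b + 3" unfolding d_def by blast
      also have "\<dots> \<le> K * 1" by (simp add: K_def)
      finally have "\<bar>d t\<bar> \<le> K * 1" .
      also have "\<dots> \<le> K * exp (2 * t)" using that b by (intro mult_left_mono) (auto simp: K_def le_max_iff_disj)
      finally show ?thesis .
    qed
    show "\<bar>g x - g y\<bar> \<le> K * \<bar>x - y\<bar>" for x y
      using clamp_powr_lipschitz[OF p, of v0 x y] v0 mult_right_mono[of "p * v0 powr (p - 1)" K "\<bar>x - y\<bar>"]
      by (simp add: g_def K_def)
  qed auto
  have w_le: "w t \<le> 0" if "t \<ge> 0" for t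
  proof -
    have "exp (D t) * w t \<le> exp (D 0) * w 0"
    proof (rule half_line_antimono[where f'="\<lambda>t. exp (D t) * g (v t)"])
      show "((\<lambda>t. exp (D t) * w t) has_real_derivative exp (D t) * g (v t)) (at t within {0..})" if "t \<ge> 0" for t
        by (rule integrating_factor_half_line[where d=d, OF D vw(4)[OF that]])
    qed (use that g in \<open>auto simp: mult_nonneg_nonpos\<close>)
    then show ?thesis by (simp add: vw(2) mult_le_0_iff)
  qed
  have v_le: "v t \<le> v0" if "t \<ge> 0" for t
    using half_line_antimono[OF vw(3) w_le that] vw(1) by simp
  define \<kappa> where "\<kappa> t = b / 2 * exp (- ((b + 3) / 2) * exp (-2 * t))" for t
  have \<kappa>_der: "(\<kappa> has_real_derivative \<kappa> t * ((b + 3) * exp (-2 * t))) (at t within {0..})" for t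
    unfolding \<kappa>_def[abs_def] by (rule has_field_derivative_at_within) (auto intro!: derivative_eq_intros)
  have \<kappa>_le: "\<kappa> t \<le> b / 2" "\<kappa> t > 0" for t using b by (auto simp: \<kappa>_def)
  \<comment> \<open>The least value of \<open>\<kappa>\<close> is attained at \<open>t = 0\<close>,
    and \<open>b / 2\<close> times it is the smallness bound assumed for
    \<open>v0 powr (p - 1)\<close>.\<close>
  have \<kappa>_ge: "b / 2 * exp (- (b + 3) / 2) \<le> \<kappa> t" if "t \<ge> 0" for t
  proof -
    have "(b + 3) / 2 * exp (-2 * t) \<le> (b + 3) / 2 * 1" using that b by (intro mult_left_mono) auto
    then have "- (b + 3) / 2 \<le> - ((b + 3) / 2) * exp (-2 * t)" by (simp add: algebra_simps)
    then show ?thesis unfolding \<kappa>_def using b by (intro mult_left_mono) auto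
  qed
  define \<phi> where "\<phi> t = \<kappa> t * v t + w t" for t
  define \<phi>' where "\<phi>' t = \<kappa> t * ((b + 3) * exp (-2 * t)) * v t + w t * \<kappa> t + (- d t * w t + g (v t))" for t
  have \<phi>_der: "(\<phi> has_real_derivative \<phi>' t) (at t within {0..})" if "t \<ge> 0" for t
    unfolding \<phi>_def[abs_def] \<phi>'_def by (intro DERIV_add DERIV_mult \<kappa>_der vw that)
  \<comment> \<open>After regrouping, \<open>\<phi>' = (\<kappa> - d) * \<phi> + (v * (b - \<kappa>)
    * \<kappa> + g v)\<close>. The bracket is nonnegative by smallness, since
    \<open>b - \<kappa> \<ge> b / 2\<close>, and \<open>\<kappa> - d \<ge> - b\<close>.\<close>
  have \<phi>'_ge: "\<phi>' t \<ge> - b * \<phi> t" if t: "t \<ge> 0" "v t > 0" "\<phi> t > 0" for t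
  proof -
    have "v t powr p \<le> v t * v0 powr (p - 1)" using v_le t p by (intro powr_p_le) auto
    also have "\<dots> \<le> v t * (b\<^sup>2 / 4 * exp (- (b + 3) / 2))" using v0 t by (intro mult_left_mono) auto
    also have "\<dots> = v t * (b / 2 * (b / 2 * exp (- (b + 3) / 2)))" by (simp add: power2_eq_square)
    also have "\<dots> \<le> v t * ((b - \<kappa> t) * \<kappa> t)"
      using \<kappa>_ge[OF t(1)] \<kappa>_le[of t] t b by (intro mult_left_mono mult_mono) auto
    finally have 1: "- (v t * ((b - \<kappa> t) * \<kappa> t)) \<le> g (v t)"
      using t v_le[of t] by (simp add: g_def clamp_eq)
    have "\<phi>' t = (\<kappa> t - d t) * \<phi> t + (v t * ((b - \<kappa> t) * \<kappa> t) + g (v t))"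
      by (simp add: \<phi>'_def \<phi>_def d_def algebra_simps)
    moreover have "- b * \<phi> t \<le> (\<kappa> t - d t) * \<phi> t"
      using t b \<kappa>_le(2)[of t] by (intro mult_right_mono) (auto simp: d_def intro!: add_nonneg_nonneg)
    ultimately show ?thesis using 1 by linarith
  qed
  have w_ge: "w t \<ge> - (b / 2) * v t" if "min (v t) (\<phi> t) > 0" for t
  proof -
    have "\<kappa> t * v t \<le> b / 2 * v t" using \<kappa>_le(1)[of t] that by (intro mult_right_mono) auto
    moreover have "\<kappa> t * v t + w t > 0" using that by (simp add: \<phi>_def)
    ultimately show ?thesis by linarith
  qed
  \<comment> \<open>The estimate for \<open>\<phi>\<close> presupposes \<open>v > 0\<close> and the
    one for \<open>v\<close> presupposes \<open>\<phi> > 0\<close>, so both are followed to the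
    first zero of their minimum.\<close>
  have v_pos: "min (v T) (\<phi> T) > 0" if T: "T \<ge> 0" for T
  proof (rule ccontr)
    assume "\<not> min (v T) (\<phi> T) > 0"
    then have stop: "min (v T) (\<phi> T) \<le> 0" by (simp only: not_less)
    have cont: "continuous_on {0..T} (\<lambda>t. min (v t) (\<phi> t))"
      by (intro continuous_intros half_line_cont[OF vw(3)] half_line_cont[OF \<phi>_der]) auto
    have \<phi>0: "\<phi> 0 > 0" using vw(1,2) v0 \<kappa>_le(2)[of 0] by (simp add: \<phi>_def)
    then have start: "min (v 0) (\<phi> 0) > 0" using vw(1) v0(1) by simp
    obtain \<tau> where "\<tau> \<le> T" and \<tau>: "0 < \<tau>" "min (v \<tau>) (\<phi> \<tau>) = 0"
        "\<And>s. 0 \<le> s \<Longrightarrow> s < \<tau> \<Longrightarrow> min (v s) (\<phi> s) > 0"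
      using first_exit[OF cont T start stop] by metis
    have "\<phi> 0 * exp (- b * \<tau>) \<le> \<phi> \<tau>"
      by (rule half_line_decay[OF \<phi>_der]) (use \<phi>'_ge \<tau> in auto)
    then have "\<phi> \<tau> > 0" using \<phi>0 by (smt (verit) exp_gt_zero mult_pos_pos)
    moreover have "v 0 * exp (- (b / 2) * \<tau>) \<le> v \<tau>"
      by (rule half_line_decay[OF vw(3)]) (use w_ge \<tau> in auto)
    then have "v \<tau> > 0" using v0 vw(1) by (smt (verit) exp_gt_zero mult_pos_pos)
    ultimately show False using \<tau>(2) by auto
  qed
  have lower: "v0 * exp (- (b / 2) * T) \<le> v T" if "T \<ge> 0" for T
    unfolding vw(1)[symmetric]
    by (rule half_line_decay[OF vw(3)]) (use w_ge v_pos that in auto)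
  show ?thesis
  proof (rule that[of v w])
    show "(w has_real_derivative - (b - (b + 3) * exp (-2 * t)) * w t - v t powr p) (at t within {0..})"
      if "t \<ge> 0" for t
      using vw(4)[OF that] v_pos[OF that] v_le[OF that] by (simp add: g_def clamp_eq d_def)
  qed (use vw lower in auto)
qed

subsection \<open>Singular positive solutions\<close>

text \<open>The second derivative is continuous automatically, because the equation expresses it
  through \<open>u\<close> and \<open>u'\<close>.\<close>

lemma singular_positive_solutionI:
  fixes u u' :: "real \<Rightarrow> real"
  assumes u: "\<And>r. r > 0 \<Longrightarrow> (u has_real_derivative u' r) (at r)"
    and u': "\<And>r. r > 0 \<Longrightarrow> (u' has_real_derivative
      - ((real N - 1) / r + r / 2) * u' r - 1 / (p - 1) * u r - u r powr p) (at r)"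
    and pos: "\<And>r. r > 0 \<Longrightarrow> u r > 0"
    and top: "filterlim u at_top (at_right 0)"
  shows "singular_positive_solution N p u"
proof -
  define u'' where "u'' r = - ((real N - 1) / r + r / 2) * u' r - 1 / (p - 1) * u r - u r powr p" for r
  have d1: "deriv u r = u' r" if "r > 0" for r using u[OF that] by (rule DERIV_imp_deriv)
  have u'': "(deriv u has_real_derivative u'' r) (at r)" if "r > 0" for r
    by (rule has_field_derivative_transform_within_open[of u' _ _ "{0<..}"])
       (use u'[OF that] d1 that in \<open>auto simp: u''_def\<close>)
  have d2: "deriv (deriv u) r = u'' r" if "r > 0" for r using u''[OF that] by (rule DERIV_imp_deriv)
  have "continuous_on {0<..} u" "continuous_on {0<..} u'"
    using u u' by (auto intro!: continuous_at_imp_continuous_on DERIV_isCont)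
  then have "continuous_on {0<..} u''"
    unfolding u''_def[abs_def] using pos by (intro continuous_intros) (auto simp: less_imp_neq[symmetric])
  then have "deriv u C1_differentiable_on {0<..}"
    unfolding C1_differentiable_on_def
    using u'' by (auto simp: has_real_derivative_iff_has_vector_derivative intro!: exI[of _ u''])
  moreover have "u differentiable (at r)" if "r > 0" for r
    using u[OF that] real_differentiable_def by blast
  moreover have "solves_E N p u"
    unfolding solves_E_def
  proof (intro allI impI)
    have eq: "- x * y - z - k + x * y + z + k = 0" for x y z k :: real by simp
    show "deriv (deriv u) r + ((real N - 1) / r + r / 2) * deriv u r + 1 / (p - 1) * u r + u r powr p = 0"
      if "r > 0" for r
      unfolding d2[OF that] d1[OF that] u''_def by (rule eq)
  qed
  ultimately show ?thesis
    using pos top by (auto simp: singular_positive_solution_def C2_on_def)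
qed

lemma singular_positive_solutionD:
  assumes "singular_positive_solution N p u" "r > 0"
  shows "(u has_real_derivative deriv u r) (at r)"
    and "(deriv u has_real_derivative
      - ((real N - 1) / r + r / 2) * deriv u r - 1 / (p - 1) * u r - u r powr p) (at r)"
proof -
  have C2: "C2_on u {0<..}" and E: "solves_E N p u"
    using assms by (auto simp: singular_positive_solution_def)
  show "(u has_real_derivative deriv u r) (at r)"
    using C2 assms(2) by (auto simp: C2_on_def DERIV_deriv_iff_real_differentiable)
  obtain D where "(deriv u has_vector_derivative D r) (at r)"
    using C2 assms(2) by (auto simp: C2_on_def C1_differentiable_on_def)
  then have "(deriv u has_real_derivative D r) (at r)"
    by (simp add: has_real_derivative_iff_has_vector_derivative)
  moreover from this have "D r = deriv (deriv u) r" by (simp add: DERIV_imp_deriv)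
  moreover have "deriv (deriv u) r = - ((real N - 1) / r + r / 2) * deriv u r - 1 / (p - 1) * u r - u r powr p"
    using E assms(2) unfolding solves_E_def by (auto simp: algebra_simps)
  ultimately show "(deriv u has_real_derivative
      - ((real N - 1) / r + r / 2) * deriv u r - 1 / (p - 1) * u r - u r powr p) (at r)"
    by simp
qed

lemma singular_positive_solution_flow:
  assumes sol: "singular_positive_solution N p u"
    and N: "N \<ge> 3" and p: "p > 1" and ap: "a * (p - 1) = 2" and an: "a \<le> real N - 2" "real N - 2 < 2 * a"
  shows "singular_flow (real N - 2) p a (\<lambda>s. u (exp (- s))) (\<lambda>s. - exp (- s) * deriv u (exp (- s)))"
proof
  note D = singular_positive_solutionD[OF sol]
  have a2: "1 / (p - 1) = a / 2" using ap p by (simp add: field_simps)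
  have e: "((\<lambda>s. exp (- s)) has_real_derivative - exp (- s)) (at s)" for s :: real
    by (auto intro!: derivative_eq_intros)
  show "((\<lambda>s. u (exp (- s))) has_real_derivative - exp (- s) * deriv u (exp (- s))) (at s)" for s
    using DERIV_chain2[OF D(1)[of "exp (- s)"] e[of s]] by (simp add: mult.commute)
  show "((\<lambda>s. - exp (- s) * deriv u (exp (- s))) has_real_derivative
      (real N - 2 + exp (-2 * s) / 2) * (- exp (- s) * deriv u (exp (- s))) -
      exp (-2 * s) * (a / 2 * u (exp (- s)) + u (exp (- s)) powr p)) (at s)" for s
  proof -
    define \<rho> where "\<rho> = exp (- s)"
    have \<rho>: "\<rho> > 0" "exp (-2 * s) = \<rho> * \<rho>" by (auto simp: \<rho>_def mult_exp_exp)
    have "((\<lambda>s. - exp (- s) * deriv u (exp (- s))) has_real_derivative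
        (- (- \<rho>)) * deriv u \<rho> + ((- ((real N - 1) / \<rho> + \<rho> / 2) * deriv u \<rho> - a / 2 * u \<rho> - u \<rho> powr p) * (- \<rho>)) * (- \<rho>)) (at s)"
      unfolding \<rho>_def
      by (rule DERIV_mult[OF DERIV_minus[OF e] DERIV_chain2[OF _ e]])
         (use D(2)[of "exp (- s)"] a2 in simp)
    then show ?thesis
    proof (rule DERIV_cong)
      have "(- (- \<rho>)) * x + ((- ((real N - 1) / \<rho> + \<rho> / 2) * x - k * y - z) * (- \<rho>)) * (- \<rho>)
          = (real N - 2 + \<rho> * \<rho> / 2) * (- \<rho> * x) - \<rho> * \<rho> * (k * y + z)" for x y z k
        using \<rho>(1) by (simp add: field_simps)
      then show "(- (- \<rho>)) * deriv u \<rho> + ((- ((real N - 1) / \<rho> + \<rho> / 2) * deriv u \<rho> - a / 2 * u \<rho> - u \<rho> powr p) * (- \<rho>)) * (- \<rho>) =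
        (real N - 2 + exp (-2 * s) / 2) * (- exp (- s) * deriv u (exp (- s))) -
        exp (-2 * s) * (a / 2 * u (exp (- s)) + u (exp (- s)) powr p)"
        unfolding \<rho>(2) \<rho>_def[symmetric] .
    qed
  qed
  have "LIM s at_top. exp (- s) :> at_right (0::real)"
    by (auto simp: filterlim_at intro!: filterlim_compose[OF exp_at_bot] filterlim_uminus_at_bot_at_top)
  then show "filterlim (\<lambda>s. u (exp (- s))) at_top at_top"
    using sol unfolding singular_positive_solution_def by (auto intro: filterlim_compose)
qed (use sol N p ap an in \<open>auto simp: singular_positive_solution_def\<close>)

lemma filterlim_minus_ln_at_right_0: "LIM r at_right (0::real). - ln r :> at_top"
  using ln_at_0 by (simp add: filterlim_uminus_at_top)

text \<open>Reflection flips the sign of the derivative, so the one-sided derivatives at 0 agree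
  under the last hypothesis. It is used for the position, where both speeds vanish, and for the
  velocity, where the two forces coincide.\<close>

lemma DERIV_glue:
  fixes f g f' g' :: "real \<Rightarrow> real"
  assumes f: "\<And>t. t \<ge> 0 \<Longrightarrow> (f has_real_derivative f' t) (at t within {0..})"
    and g: "\<And>t. t \<ge> 0 \<Longrightarrow> (g has_real_derivative g' t) (at t within {0..})"
    and "f 0 = g 0" "f' 0 = - g' 0"
  shows "((\<lambda>t. if t \<ge> 0 then f t else g (- t)) has_real_derivative
      (if t \<ge> 0 then f' t else - g' (- t))) (at t)"
proof -
  define h where "h t = (if t \<ge> 0 then f t else g (- t))" for t
  have g2: "((\<lambda>t. g (- t)) has_real_derivative - g' (- t)) (at t within {..0})" if "t \<le> 0" for t
  proof -
    have "(\<lambda>t::real. - t) ` {..0} = {0..}"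
      by (auto simp: image_iff intro: bexI[of _ "- _"])
    then have "(g has_real_derivative g' (- t)) (at (- t) within (\<lambda>t. - t) ` {..0})"
      using g[of "- t"] that by simp
    moreover have "((\<lambda>t. - t) has_real_derivative - 1) (at t within {..0})"
      by (auto intro!: derivative_eq_intros)
    ultimately have "(g \<circ> (\<lambda>t. - t) has_real_derivative g' (- t) * - 1) (at t within {..0})"
      by (rule DERIV_image_chain)
    then show ?thesis by (simp add: o_def)
  qed
  have "(h has_real_derivative (if t \<ge> 0 then f' t else - g' (- t))) (at t)"
  proof (cases t "0::real" rule: linorder_cases)
    case greater
    then show ?thesis
      using has_field_derivative_transform_within_open[OF DERIV_half_line[OF f], of t "{0<..}" h]
      by (auto simp: h_def)
  next
    case less
    have "(g has_real_derivative g' (- t)) (at (- t))"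
      by (rule DERIV_half_line[OF g]) (use less in auto)
    then have "((\<lambda>t. g (- t)) has_real_derivative g' (- t) * - 1) (at t)"
      by (rule DERIV_chain2) (auto intro!: derivative_eq_intros)
    then have "((\<lambda>t. g (- t)) has_real_derivative - g' (- t)) (at t)" by simp
    from has_field_derivative_transform_within_open[OF this, of "{..<0}" h] less show ?thesis
      by (auto simp: h_def)
  next
    case equal
    have 1: "(h has_real_derivative f' 0) (at 0 within {0..})"
      unfolding has_field_derivative_def
      by (rule has_derivative_transform[OF _ _ f[unfolded has_field_derivative_def]]) (auto simp: h_def)
    have "(h has_real_derivative - g' (- 0)) (at 0 within {..0})"
      unfolding has_field_derivative_def
      by (rule has_derivative_transform[OF _ _ g2[unfolded has_field_derivative_def]])
         (use \<open>f 0 = g 0\<close> in \<open>auto simp: h_def\<close>)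
    then have 2: "(h has_real_derivative f' 0) (at 0 within {..0})" using \<open>f' 0 = - g' 0\<close> by simp
    have "(h has_real_derivative f' 0) (at 0 within {0..} \<union> {..0})"
      using 1 2 unfolding has_field_derivative_iff by (rule Lim_Un)
    moreover have "{0..} \<union> {..0} = (UNIV :: real set)" by auto
    ultimately show ?thesis using equal by simp
  qed
  then show ?thesis by (simp add: h_def[abs_def])
qed

text \<open>Self-similar variables: \<open>u r = r powr (- a) * V (ln (r / \<rho>))\<close>.\<close>

lemma solution_of_half_lines:
  fixes N :: nat and p a b c \<rho> :: real and vf wf vb wb :: "real \<Rightarrow> real"
  assumes p: "p > 1" and ap: "a * (p - 1) = 2" and \<rho>: "\<rho> > 0"
    and b: "b = 2 * a - (real N - 2)" and c: "c = a * (real N - 2 - a)"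
    and vf: "\<And>t. t \<ge> 0 \<Longrightarrow> (vf has_real_derivative wf t) (at t within {0..})"
    and wf: "\<And>t. t \<ge> 0 \<Longrightarrow> (wf has_real_derivative
      - (\<rho>\<^sup>2 / 2 * exp (2 * t) - b) * wf t + (c * vf t - vf t powr p)) (at t within {0..})"
    and vb: "\<And>t. t \<ge> 0 \<Longrightarrow> (vb has_real_derivative wb t) (at t within {0..})"
    and wb: "\<And>t. t \<ge> 0 \<Longrightarrow> (wb has_real_derivative
      - (b - \<rho>\<^sup>2 / 2 * exp (-2 * t)) * wb t + (c * vb t - vb t powr p)) (at t within {0..})"
    and init: "vf 0 = vb 0" "wf 0 = 0" "wb 0 = 0"
    and pos: "\<And>t. t \<ge> 0 \<Longrightarrow> vf t > 0" "\<And>t. t \<ge> 0 \<Longrightarrow> vb t > 0"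
    and top: "filterlim (\<lambda>t. exp (a * t) * vb t) at_top at_top"
  shows "\<exists>u \<in> singular_positive_solutions N p. u \<rho> = exp (- a * ln \<rho>) * vf 0"
proof -
  define V where "V t = (if t \<ge> 0 then vf t else vb (- t))" for t
  define W where "W t = (if t \<ge> 0 then wf t else - wb (- t))" for t
  have V: "(V has_real_derivative W t) (at t)" for t
    unfolding V_def[abs_def] W_def by (rule DERIV_glue[OF vf vb]) (use init in auto)
  have Wlem: "((\<lambda>t. if t \<ge> 0 then wf t else (\<lambda>t. - wb t) (- t)) has_real_derivative
      (if t \<ge> 0 then - (\<rho>\<^sup>2 / 2 * exp (2 * t) - b) * wf t + (c * vf t - vf t powr p)
       else - (- (- (b - \<rho>\<^sup>2 / 2 * exp (-2 * (- t))) * wb (- t) + (c * vb (- t) - vb (- t) powr p))))) (at t)" for t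
    by (rule DERIV_glue[OF wf DERIV_minus[OF wb]]) (use init in auto)
  have W: "(W has_real_derivative (b - \<rho>\<^sup>2 / 2 * exp (2 * t)) * W t + (c * V t - V t powr p)) (at t)" for t
    unfolding W_def[abs_def] by (rule DERIV_cong[OF Wlem]) (simp add: V_def algebra_simps)
  have V_pos: "V t > 0" for t using pos by (simp add: V_def)
  define u where "u r = exp (- a * ln r) * V (ln r - ln \<rho>)" for r
  define u' where "u' r = exp (- a * ln r) / r * (W (ln r - ln \<rho>) - a * V (ln r - ln \<rho>))" for r
  have u_pos: "u r > 0" for r using V_pos by (simp add: u_def)
  have l: "((\<lambda>r. ln r - ln \<rho>) has_real_derivative 1 / r) (at r)" if "r > 0" for r
    using that by (auto intro!: derivative_eq_intros)
  have ex: "((\<lambda>r. exp (- a * ln r)) has_real_derivative - a * (exp (- a * ln r) / r)) (at r)" if "r > 0" for r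
    using that by (auto intro!: derivative_eq_intros)
  have u: "(u has_real_derivative u' r) (at r)" if r: "r > 0" for r
    unfolding u_def[abs_def] u'_def
    by (rule DERIV_cong[OF DERIV_mult[OF ex[OF r] DERIV_chain2[OF V l[OF r]]]]) (simp add: algebra_simps)
  have u': "(u' has_real_derivative
      - ((real N - 1) / r + r / 2) * u' r - 1 / (p - 1) * u r - u r powr p) (at r)" if r: "r > 0" for r
  proof -
    define t x y e where "t = ln r - ln \<rho>" and "x = V t" and "y = W t" and "e = exp (- a * ln r)"
    \<comment> \<open>The damping written in \<open>t = ln (r / \<rho>)\<close> turns back into
      \<open>r\<^sup>2 / 2\<close>.\<close>
    have expt: "\<rho>\<^sup>2 / 2 * exp (2 * t) = r\<^sup>2 / 2"
    proof -
      have "exp (2 * t) = (exp t)\<^sup>2" by (simp add: power2_eq_square mult_exp_exp)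
      also have "exp t = r / \<rho>" using r \<rho> by (simp add: t_def exp_diff)
      finally show ?thesis using \<rho> by (simp add: power2_eq_square)
    qed
    have D: "(u' has_real_derivative
        ((- a * (e / r)) * r - e * 1) / (r * r) * (y - a * x)
        + (((b - r\<^sup>2 / 2) * y + (c * x - x powr p)) * (1 / r) - a * (y * (1 / r))) * (e / r)) (at r)"
      unfolding u'_def[abs_def] e_def x_def y_def t_def expt[unfolded t_def, symmetric]
      using r by (intro DERIV_mult DERIV_divide DERIV_diff DERIV_cmult DERIV_chain2[OF W l] DERIV_chain2[OF V l] ex DERIV_ident) auto
    have "u r powr p = exp (- a * ln r * p) * x powr p"
      using V_pos[of t] by (simp add: u_def x_def t_def powr_mult exp_powr_real)
    \<comment> \<open>The scaling identity \<open>a * p = a + 2\<close>: \<open>u powr p\<close>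
      carries the same power of \<open>r\<close> as \<open>u''\<close>.\<close>
    also have "- a * ln r * p = - a * ln r + - (2 * ln r)"
      unfolding ap[symmetric] by (simp add: algebra_simps)
    also have "exp \<dots> = e * exp (- (2 * ln r))" by (simp only: exp_add e_def)
    also have "exp (- (2 * ln r)) = 1 / r\<^sup>2"
      using r by (simp add: exp_minus exp_double inverse_eq_divide)
    also have "e * (1 / r\<^sup>2) = e / r\<^sup>2" by simp
    finally have up: "u r powr p = e / r\<^sup>2 * x powr p" .
    have a2: "1 / (p - 1) = a / 2" using ap p by (simp add: field_simps)
    have ur: "u r = e * x" "u' r = e / r * (y - a * x)" by (auto simp: u_def u'_def e_def x_def y_def t_def)
    show ?thesis
    proof (rule DERIV_cong[OF D])
      show "((- a * (e / r)) * r - e * 1) / (r * r) * (y - a * x)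
        + (((b - r\<^sup>2 / 2) * y + (c * x - x powr p)) * (1 / r) - a * (y * (1 / r))) * (e / r)
        = - ((real N - 1) / r + r / 2) * u' r - 1 / (p - 1) * u r - u r powr p"
        unfolding up unfolding a2 ur b c using r by (simp add: field_simps power2_eq_square)
    qed
  qed
  have u_top: "filterlim u at_top (at_right 0)"
  proof -
    have L: "LIM r at_right 0. ln \<rho> + - ln r :> at_top"
      by (rule filterlim_tendsto_add_at_top[OF tendsto_const filterlim_minus_ln_at_right_0])
    have "LIM r at_right 0. exp (- a * ln \<rho>) * (exp (a * (ln \<rho> + - ln r)) * vb (ln \<rho> + - ln r)) :> at_top"
      by (rule filterlim_tendsto_pos_mult_at_top[OF tendsto_const _ filterlim_compose[OF top L]]) simp
    moreover have "exp (- a * ln \<rho>) * (exp (a * (ln \<rho> + - ln r)) * vb (ln \<rho> + - ln r)) = u r"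
      if "0 < r" "r < \<rho>" for r
    proof -
      have "exp (- a * ln \<rho>) * exp (a * (ln \<rho> + - ln r)) = exp (- a * ln r)"
        unfolding mult_exp_exp by (simp add: algebra_simps)
      moreover have "ln r < ln \<rho>" using that by simp
      ultimately show ?thesis by (simp add: u_def V_def mult.assoc[symmetric])
    qed
    then have "eventually (\<lambda>r. exp (- a * ln \<rho>) * (exp (a * (ln \<rho> + - ln r)) * vb (ln \<rho> + - ln r)) = u r) (at_right 0)"
      using \<rho> unfolding eventually_at_right_field by blast
    ultimately show ?thesis using filterlim_cong by force
  qed
  define ur where "ur = restrict u {0<..}"
  have "singular_positive_solution N p ur"
  proof (rule singular_positive_solutionI[where u'=u'])
    show "(ur has_real_derivative u' r) (at r)" if "r > 0" for r
      by (rule has_field_derivative_transform_within_open[OF u[OF that], of "{0<..}"]) (use that in \<open>auto simp: ur_def\<close>)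
    show "(u' has_real_derivative
        - ((real N - 1) / r + r / 2) * u' r - 1 / (p - 1) * ur r - ur r powr p) (at r)" if "r > 0" for r
      using u'[OF that] that by (simp add: ur_def)
    have "eventually (\<lambda>r. u r = ur r) (at_right 0)"
      unfolding eventually_at_right_field by (auto simp: ur_def intro: exI[of _ 1])
    then show "filterlim ur at_top (at_right 0)" using u_top filterlim_cong by force
  qed (use u_pos in \<open>auto simp: ur_def\<close>)
  moreover have "ur \<rho> = exp (- a * ln \<rho>) * vf 0" using \<rho> by (simp add: ur_def u_def V_def)
  ultimately show ?thesis by (intro bexI[of _ ur]) (auto simp: singular_positive_solutions_def ur_def)
qed

lemma exp_times_tendsto_at_top:
  assumes "a > 0" "eventually (\<lambda>t. m \<le> v t) at_top" "m > (0::real)"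
  shows "LIM t at_top. exp (a * t) * v t :> at_top"
proof (rule filterlim_at_top_mono)
  show "LIM t at_top. exp (a * t) * m :> at_top"
    using assms
    by (intro filterlim_at_top_mult_tendsto_pos[OF tendsto_const _] filterlim_compose[OF exp_at_top]
        filterlim_tendsto_pos_mult_at_top[OF tendsto_const _ filterlim_ident])
  show "eventually (\<lambda>t. exp (a * t) * m \<le> exp (a * t) * v t) at_top"
    using assms(2) by eventually_elim simp
qed

text \<open>The radius \<open>\<rho>\<close> does not depend on \<open>v0\<close>, so evaluation at
  this single point separates the solutions and takes every value of an interval.\<close>

lemma family_of_singular_solutions:
  fixes N :: nat and p a :: real
  assumes N: "N \<ge> 3" and p: "p > 1" and ap: "a * (p - 1) = 2"
    and an: "a \<le> real N - 2" "real N - 2 < 2 * a"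
  obtains \<rho> \<delta> where "\<rho> > 0" "\<delta> > 0"
    "\<And>v0. 0 < v0 \<Longrightarrow> v0 < \<delta> \<Longrightarrow> \<exists>u \<in> singular_positive_solutions N p. u \<rho> = exp (- a * ln \<rho>) * v0"
proof -
  define n where "n = real N - 2"
  have n: "n \<ge> 1" using N by (simp add: n_def)
  define b where "b = 2 * a - n"
  define c where "c = a * (n - a)"
  have b: "b > 0" and a: "a > 0" using an n by (auto simp: b_def n_def)
  have bc: "b = 2 * a - (real N - 2)" "c = a * (real N - 2 - a)" by (auto simp: b_def c_def n_def)
  show ?thesis
  proof (cases "c > 0")
    case True
    \<comment> \<open>Here \<open>\<rho>\<^sup>2 / 2 = b\<close>, the radius where the damping
      vanishes; the coefficient is then nonnegative along both half-lines.\<close>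
    define \<rho> where "\<rho> = sqrt (2 * b)"
    have \<rho>: "\<rho> > 0" "\<rho>\<^sup>2 / 2 = b" using b by (auto simp: \<rho>_def)
    show ?thesis
    proof (rule that[of \<rho> "((p + 1) * c / 2) powr (1 / (p - 1))"])
      fix v0 :: real assume v0: "0 < v0" "v0 < ((p + 1) * c / 2) powr (1 / (p - 1))"
      obtain vf wf mf where f: "vf 0 = v0" "wf 0 = 0" "mf > 0" "\<And>t. t \<ge> 0 \<Longrightarrow> vf t > mf"
        "\<And>t. t \<ge> 0 \<Longrightarrow> (vf has_real_derivative wf t) (at t within {0..})"
        "\<And>t. t \<ge> 0 \<Longrightarrow> (wf has_real_derivative - (b * exp (2 * t) - b) * wf t + (c * vf t - vf t powr p)) (at t within {0..})"
      proof (rule trapped_half_line[OF p True _ _ _ v0, of "\<lambda>t. b * exp (2 * t) - b" b])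
        show "0 \<le> b * exp (2 * t) - b" if "t \<ge> 0" for t
          using mult_left_mono[of 1 "exp (2 * t)" b] that b by simp
      qed (use b in \<open>auto intro!: continuous_intros\<close>)
      obtain vb wb mb where bk: "vb 0 = v0" "wb 0 = 0" "mb > 0" "\<And>t. t \<ge> 0 \<Longrightarrow> vb t > mb"
        "\<And>t. t \<ge> 0 \<Longrightarrow> (vb has_real_derivative wb t) (at t within {0..})"
        "\<And>t. t \<ge> 0 \<Longrightarrow> (wb has_real_derivative - (b - b * exp (-2 * t)) * wb t + (c * vb t - vb t powr p)) (at t within {0..})"
      proof (rule trapped_half_line[OF p True _ _ _ v0, of "\<lambda>t. b - b * exp (-2 * t)" b])
        show "0 \<le> b - b * exp (-2 * t)" if "t \<ge> 0" for t
          using mult_left_mono[of "exp (-2 * t)" 1 b] that b by simp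
        show "b - b * exp (-2 * t) \<le> b * exp (2 * t)" if "t \<ge> 0" for t
        proof -
          have "b * 1 \<le> b * exp (2 * t)" using that b by (intro mult_left_mono) auto
          moreover have "b * exp (-2 * t) > 0" using b by simp
          ultimately show ?thesis by linarith
        qed
      qed (auto intro!: continuous_intros)
      have "eventually (\<lambda>t. mb \<le> vb t) at_top"
        using bk(4) by (auto simp: eventually_at_top_linorder intro!: exI[of _ 0] less_imp_le)
      then have top: "LIM t at_top. exp (a * t) * vb t :> at_top"
        by (rule exp_times_tendsto_at_top[OF a _ bk(3)])
      have "\<exists>u \<in> singular_positive_solutions N p. u \<rho> = exp (- a * ln \<rho>) * vf 0"
      proof (rule solution_of_half_lines[OF p ap \<rho>(1) bc f(5) _ bk(5) _ _ f(2) bk(2) _ _ top])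
        show "vf t > 0" "vb t > 0" if "t \<ge> 0" for t using f(3) f(4)[OF that] bk(3) bk(4)[OF that] by auto
      qed (use f bk in \<open>auto simp: \<rho>(2)\<close>)
      then show "\<exists>u \<in> singular_positive_solutions N p. u \<rho> = exp (- a * ln \<rho>) * v0" using f(1) by simp
    qed (use \<rho> p True in auto)
  next
    case False
    then have c0: "c = 0" and na: "a = n"
      using a an(1) by (auto simp: c_def n_def zero_less_mult_iff)
    then have ba: "b = a" by (simp add: b_def)
    \<comment> \<open>The larger radius makes the initial forward damping equal to 3, as the forward
      barrier demands.\<close>
    define \<rho> where "\<rho> = sqrt (2 * (b + 3))"
    have \<rho>: "\<rho> > 0" "\<rho>\<^sup>2 / 2 = b + 3" using b by (auto simp: \<rho>_def)
    define k where "k = min 1 (b\<^sup>2 / 4 * exp (- (b + 3) / 2))"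
    have k: "k > 0" using b by (simp add: k_def)
    show ?thesis
    proof (rule that[of \<rho> "k powr (1 / (p - 1))"])
      fix v0 :: real assume v0: "0 < v0" "v0 < k powr (1 / (p - 1))"
      have "v0 powr (p - 1) \<le> (k powr (1 / (p - 1))) powr (p - 1)"
        using v0 p by (intro powr_mono2) auto
      then have "v0 powr (p - 1) \<le> k" using p k by (simp add: powr_powr)
      then have small: "v0 powr (p - 1) \<le> 1" "v0 powr (p - 1) \<le> b\<^sup>2 / 4 * exp (- (b + 3) / 2)"
        by (auto simp: k_def)
      obtain vf wf where f: "vf 0 = v0" "wf 0 = 0" "\<And>t. t \<ge> 0 \<Longrightarrow> vf t > 0"
        "\<And>t. t \<ge> 0 \<Longrightarrow> (vf has_real_derivative wf t) (at t within {0..})"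
        "\<And>t. t \<ge> 0 \<Longrightarrow> (wf has_real_derivative - ((b + 3) * exp (2 * t) - b) * wf t - vf t powr p) (at t within {0..})"
        by (rule small_forward_half_line[OF p b v0(1) small(1)]) blast
      obtain vb wb where bk: "vb 0 = v0" "wb 0 = 0" "\<And>t. t \<ge> 0 \<Longrightarrow> vb t \<ge> v0 * exp (- (b / 2) * t)"
        "\<And>t. t \<ge> 0 \<Longrightarrow> (vb has_real_derivative wb t) (at t within {0..})"
        "\<And>t. t \<ge> 0 \<Longrightarrow> (wb has_real_derivative - (b - (b + 3) * exp (-2 * t)) * wb t - vb t powr p) (at t within {0..})"
        by (rule small_backward_half_line[OF p b v0(1) small(2)]) blast
      \<comment> \<open>Backward \<open>v\<close> may decay, but at most at rate
        \<open>b / 2 = a / 2\<close>: one half of the factor \<open>exp (a * t)\<close> compensates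
        this, the other half diverges.\<close>
      have "v0 \<le> exp (b / 2 * t) * vb t" if "t \<ge> 0" for t
        using bk(3)[OF that] by (simp add: exp_minus field_simps)
      then have "eventually (\<lambda>t. v0 \<le> exp (b / 2 * t) * vb t) at_top"
        by (auto simp: eventually_at_top_linorder)
      then have "LIM t at_top. exp (b / 2 * t) * (exp (b / 2 * t) * vb t) :> at_top"
        using b v0(1) by (intro exp_times_tendsto_at_top[where m=v0]) auto
      moreover have "exp (b / 2 * t) * (exp (b / 2 * t) * vb t) = exp (a * t) * vb t" for t
        by (simp add: ba mult.assoc[symmetric] mult_exp_exp)
      ultimately have top: "LIM t at_top. exp (a * t) * vb t :> at_top" by (simp only:)
      have "\<exists>u \<in> singular_positive_solutions N p. u \<rho> = exp (- a * ln \<rho>) * vf 0"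
      proof (rule solution_of_half_lines[OF p ap \<rho>(1) bc f(4) _ bk(4) _ _ f(2) bk(2) f(3) _ top])
        show "vb t > 0" if "t \<ge> 0" for t
          using bk(3)[OF that] v0(1) by (smt (verit) exp_gt_zero mult_pos_pos)
      qed (use f bk c0 in \<open>auto simp: \<rho>(2)\<close>)
      then show "\<exists>u \<in> singular_positive_solutions N p. u \<rho> = exp (- a * ln \<rho>) * v0" using f(1) by simp
    qed (use \<rho> k in auto)
  qed
qed

subsection \<open>Cardinality\<close>

lemma continuous_eq_on_rats:
  fixes f g :: "real \<Rightarrow> real"
  assumes f: "\<And>r. r > 0 \<Longrightarrow> isCont f r" and g: "\<And>r. r > 0 \<Longrightarrow> isCont g r"
    and eq: "\<And>q :: rat. q > 0 \<Longrightarrow> f (of_rat q) = g (of_rat q)" and "r > 0"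
  shows "f r = g r"
proof (rule ccontr)
  assume "f r \<noteq> g r"
  then have "f r - g r \<noteq> 0" by simp
  moreover have "((\<lambda>x. f x - g x) \<longlongrightarrow> f r - g r) (at r)"
    using f[OF \<open>r > 0\<close>] g[OF \<open>r > 0\<close>] by (intro tendsto_diff) (auto simp: isCont_def)
  ultimately have "eventually (\<lambda>x. f x - g x \<noteq> 0) (at r)"
    using tendsto_imp_eventually_ne by blast
  then obtain d where d: "d > 0" "\<And>x. x \<noteq> r \<Longrightarrow> dist x r < d \<Longrightarrow> f x - g x \<noteq> 0"
    unfolding eventually_at by auto
  obtain q :: rat where q: "r < of_rat q" "of_rat q < r + d"
    using of_rat_dense[of r "r + d"] d by auto
  then have "(0::real) < of_rat q" using \<open>r > 0\<close> q(1) by linarith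
  then have "f (of_rat q) = g (of_rat q)" using eq[of q] by simp
  with d(2)[of "of_rat q"] q show False by (simp add: dist_real_def)
qed

text \<open>A continuous function is coded by the set of rational points below its graph.\<close>

lemma continuous_functions_lepoll_reals:
  fixes S :: "(real \<Rightarrow> real) set"
  assumes ext: "S \<subseteq> extensional {0<..}" and cont: "\<And>f r. f \<in> S \<Longrightarrow> r > 0 \<Longrightarrow> isCont f r"
  shows "S \<lesssim> (UNIV :: real set)"
proof -
  define G where "G f = {(x :: rat, y :: rat). x > 0 \<and> of_rat y < f (of_rat x)}" for f :: "real \<Rightarrow> real"
  have "inj_on (\<lambda>f. to_nat ` G f) S"
  proof (rule inj_onI)
    fix f g assume fg: "f \<in> S" "g \<in> S" "to_nat ` G f = to_nat ` G g"
    then have G: "G f = G g" by (simp add: inj_image_eq_iff)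
    have "f (of_rat q) = g (of_rat q)" if q: "q > 0" for q
    proof (rule ccontr)
      assume "f (of_rat q) \<noteq> g (of_rat q)"
      then obtain y where "(f (of_rat q) < of_rat y \<and> of_rat y < g (of_rat q)) \<or>
          (g (of_rat q) < of_rat y \<and> of_rat y < f (of_rat q))"
        using of_rat_dense by (metis linorder_neqE)
      then have "((q, y) \<in> G f) \<noteq> ((q, y) \<in> G g)" using q by (auto simp: G_def)
      with G show False by simp
    qed
    then have "f r = g r" if "r > 0" for r
      using continuous_eq_on_rats[of f g r] cont fg that by blast
    with fg ext show "f = g" by (intro extensionalityI[of f "{0<..}" g]) auto
  qed
  then have "S \<lesssim> (UNIV :: nat set set)" by (auto simp: lepoll_def)
  then show ?thesis by (rule lepoll_trans[OF _ eqpoll_imp_lepoll[OF nat_sets_eqpoll_reals]])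
qed

theorem theorem1p1:
  fixes N :: nat and p :: real
  assumes "N \<ge> 3"
    and "real N / (real N - 2) \<le> p" and "p < (real N + 2) / (real N - 2)"
  shows "singular_positive_solutions N p \<approx> (UNIV :: real set)
    \<and> (real N / (real N - 2) < p \<longrightarrow>
         (\<forall>u. singular_positive_solution N p u \<longrightarrow>
            ((\<lambda>r. r powr (2 / (p - 1)) * u r) \<longlongrightarrow>
               (2 / (p - 1) * (real N - 2 - 2 / (p - 1))) powr (1 / (p - 1))) (at_right 0)))
    \<and> (p = real N / (real N - 2) \<longrightarrow>
         (\<forall>u. singular_positive_solution N p u \<longrightarrow>
            ((\<lambda>r. r ^ (N - 2) * (- ln r) powr ((real N - 2) / 2) * u r) \<longlongrightarrow>
               ((real N - 2)\<^sup>2 / 2) powr ((real N - 2) / 2)) (at_right 0)))"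
proof -
  define n where "n = real N - 2"
  define a where "a = 2 / (p - 1)"
  have n: "n \<ge> 1" using assms(1) by (simp add: n_def)
  have p2: "n + 2 \<le> p * n" "p * n < n + 4"
    using assms(2,3) n by (auto simp: n_def field_simps)
  have p: "p > 1"
  proof (rule ccontr)
    assume "\<not> p > 1"
    then have "p * n \<le> 1 * n" using n by (intro mult_right_mono) auto
    with p2 show False by simp
  qed
  have ap: "a * (p - 1) = 2" using p by (simp add: a_def divide_eq_eq)
  have an: "a \<le> n" "n < 2 * a" using p2 p by (auto simp: a_def field_simps)
  note flow = singular_positive_solution_flow[OF _ assms(1) p ap an[unfolded n_def]]

  have card: "singular_positive_solutions N p \<approx> (UNIV :: real set)"
  proof (rule lepoll_antisym)
    show "singular_positive_solutions N p \<lesssim> (UNIV :: real set)"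
    proof (rule continuous_functions_lepoll_reals)
      show "isCont f r" if "f \<in> singular_positive_solutions N p" "r > 0" for f r
      proof (rule DERIV_isCont)
        show "(f has_real_derivative deriv f r) (at r)"
          using that by (intro singular_positive_solutionD(1)) (auto simp: singular_positive_solutions_def)
      qed
    qed (auto simp: singular_positive_solutions_def)
    obtain \<rho> \<delta> where \<rho>: "\<rho> > 0" and \<delta>: "\<delta> > 0"
      and ex: "\<And>v0. 0 < v0 \<Longrightarrow> v0 < \<delta> \<Longrightarrow> \<exists>u \<in> singular_positive_solutions N p. u \<rho> = exp (- a * ln \<rho>) * v0"
      by (rule family_of_singular_solutions[OF assms(1) p ap an[unfolded n_def]]) blast
    \<comment> \<open>The interval is covered by an image of the solution set, so no choice of a
      solution for each \<open>v0\<close> is required.\<close>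
    have "{0<..<\<delta>} \<subseteq> (\<lambda>u. u \<rho> / exp (- a * ln \<rho>)) ` singular_positive_solutions N p"
    proof
      fix x assume "x \<in> {0<..<\<delta>}"
      then obtain u where "u \<in> singular_positive_solutions N p" "u \<rho> = exp (- a * ln \<rho>) * x"
        using ex[of x] by auto
      then show "x \<in> (\<lambda>u. u \<rho> / exp (- a * ln \<rho>)) ` singular_positive_solutions N p"
        by (intro image_eqI[of _ _ u]) auto
    qed
    then have "{0<..<\<delta>} \<lesssim> singular_positive_solutions N p"
      by (rule lepoll_trans[OF subset_imp_lepoll image_lepoll])
    moreover have "(UNIV :: real set) \<approx> {0<..<\<delta>}"
      by (rule eqpoll_sym) (simp only: open_interval_eqpoll_reals \<delta>)
    ultimately show "(UNIV :: real set) \<lesssim> singular_positive_solutions N p"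
      using lepoll_trans[OF eqpoll_imp_lepoll] by blast
  qed

  have supercritical: "((\<lambda>r. r powr (2 / (p - 1)) * u r) \<longlongrightarrow>
      (2 / (p - 1) * (real N - 2 - 2 / (p - 1))) powr (1 / (p - 1))) (at_right 0)"
    if "real N / (real N - 2) < p" and u: "singular_positive_solution N p u" for u
  proof -
    interpret singular_flow "real N - 2" p a "\<lambda>s. u (exp (- s))" "\<lambda>s. - exp (- s) * deriv u (exp (- s))"
      by (rule flow[OF u])
    have "n + 2 < p * n" using that(1) n by (simp add: n_def field_simps)
    then have "a < real N - 2" using p by (simp add: a_def n_def field_simps)
    from filterlim_compose[OF v_tendsto_L[OF this] filterlim_minus_ln_at_right_0]
    have "((\<lambda>r. v (- ln r)) \<longlongrightarrow> c powr (1 / (p - 1))) (at_right 0)" .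
    moreover have "v (- ln r) = r powr (2 / (p - 1)) * u r" if "r > 0" for r
    proof -
      have "v (- ln r) = r powr a * u r" using that by (simp add: v_def powr_def)
      then show ?thesis unfolding a_def .
    qed
    then have "eventually (\<lambda>r. v (- ln r) = r powr (2 / (p - 1)) * u r) (at_right 0)"
      by (simp add: eventually_at_right_less eventually_at_filter)
    ultimately have "((\<lambda>r. r powr (2 / (p - 1)) * u r) \<longlongrightarrow> c powr (1 / (p - 1))) (at_right 0)"
      using tendsto_cong by force
    then show ?thesis unfolding c_def unfolding a_def .
  qed

  have critical: "((\<lambda>r. r ^ (N - 2) * (- ln r) powr ((real N - 2) / 2) * u r) \<longlongrightarrow>
      ((real N - 2)\<^sup>2 / 2) powr ((real N - 2) / 2)) (at_right 0)"
    if "p = real N / (real N - 2)" and u: "singular_positive_solution N p u" for u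
  proof -
    interpret singular_flow "real N - 2" p a "\<lambda>s. u (exp (- s))" "\<lambda>s. - exp (- s) * deriv u (exp (- s))"
      by (rule flow[OF u])
    have "p * n = n + 2" using that(1) n by (simp add: n_def)
    \<comment> \<open>At the endpoint \<open>a = b = n\<close>, which yields the exponent
      \<open>n / 2\<close> and the constant \<open>n\<^sup>2 / 2\<close>.\<close>
    then have p1: "1 / (p - 1) = n / 2" using p n by (simp add: field_simps)
    then have an: "a = n" by (simp add: a_def)
    then have aN: "a = real N - 2" by (simp add: n_def)
    have bp: "b / (p - 1) = n\<^sup>2 / 2"
    proof -
      have "b / (p - 1) = n * (1 / (p - 1))" unfolding b_def by (simp add: an n_def)
      then show ?thesis by (simp add: p1 power2_eq_square)
    qed
    from filterlim_compose[OF v_asymp_log[OF aN] filterlim_minus_ln_at_right_0]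
    have "((\<lambda>r. (- ln r) powr (1 / (p - 1)) * v (- ln r)) \<longlongrightarrow> (b / (p - 1)) powr (1 / (p - 1))) (at_right 0)" .
    moreover have "(- ln r) powr (1 / (p - 1)) * v (- ln r) = r ^ (N - 2) * (- ln r) powr ((real N - 2) / 2) * u r"
      if "r > 0" for r
    proof -
      \<comment> \<open>The statement uses an integer power with natural subtraction;
        \<open>N \<ge> 3\<close> makes \<open>real (N - 2)\<close> agree with
        \<open>real N - 2\<close>.\<close>
      have "exp (a * ln r) = r powr real (N - 2)"
        using that assms(1) by (simp add: aN powr_def of_nat_diff)
      then have "exp (a * ln r) = r ^ (N - 2)" using that by (simp add: powr_realpow)
      then show ?thesis using that by (simp add: v_def p1 n_def)
    qed
    then have "eventually (\<lambda>r. (- ln r) powr (1 / (p - 1)) * v (- ln r)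
        = r ^ (N - 2) * (- ln r) powr ((real N - 2) / 2) * u r) (at_right 0)"
      by (simp add: eventually_at_filter)
    ultimately have "((\<lambda>r. r ^ (N - 2) * (- ln r) powr ((real N - 2) / 2) * u r)
        \<longlongrightarrow> (b / (p - 1)) powr (1 / (p - 1))) (at_right 0)"
      using tendsto_cong by force
    then show ?thesis unfolding bp p1 n_def .
  qed

  show ?thesis using card supercritical critical by blast
qed

end
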